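(* Let $n\geqslant4$ and $m=\lfloor\frac{n-1}{2}\rfloor$. Let $D=\{g,e_1,\ldots,e_n,x_1,\ldots,x_m\}$ be an alphabet (of $n+m+1$ letters) and let $Q$ consist of the following $\frac12\bigl(3n^2+(1-(-1)^n)n+3-\frac{1+(-1)^n}{2}\bigr)$ monoid relations on $D^*$: $(Q_1)$ $g^n=1$; $(Q_2)$ $e_i^2=e_i$, for $1\leqslant i\leqslant n$; $(Q_3)$ $e_ie_j=e_je_i$, for $1\leqslant i<j\leqslant n$; $(Q_4)$ $ge_1=e_ng$ and $ge_{i+1}=e_ig$, for $1\leqslant i\leqslant n-1$; $(Q_5)$ $ge_1\cdots e_n=e_1\cdots e_n$; $(Q_6)$ $e_1x_i=x_ie_1=g^{n-2i}e_1\cdots e_{n-i}e_{n-i+2}\cdots e_n$, for $1\leqslant i\leqslant m$; $(Q_7)$ $x_ie_j=x_i$, for $1\leqslant i\leqslant m$, $2\leqslant j\leqslant n$, $j\neq n-i+1$; $(Q_8)$ $e_jx_i=x_i$, for $1\leqslant i\leqslant m$, $2\leqslant j\leqslant n$, $j\neq i+1$; $(Q_9)$ $x_ie_{n-i+1}=e_{i+1}x_i=e_2\cdots e_n$, for $1\leqslant i\leqslant m$; $(Q_{10})$ $(x_ig^i)^2=e_2\cdots e_ie_{i+2}\cdots e_n$, for $1\leqslant i\leqslant m$. Then the monoid $\mathcal{OPDI}_n$ is defined by the presentation $\langle D\mid Q\rangle$.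
   Context: Let $\Omega_n=\{1<2<\cdots<n\}$. $\mathcal{I}_n$ is the symmetric inverse monoid of all partial permutations (injective partial maps) of $\Omega_n$ under composition; maps act on the right, so $\alpha\beta$ means first $\alpha$, then $\beta$. Let $g$ be the permutation $i\mapsto i+1$ ($1\leqslant i\leqslant n-1$), $n\mapsto 1$, and $h$ the permutation $i\mapsto n+1-i$; they generate the dihedral group $\mathcal{D}_{2n}$ of order $2n$ inside the symmetric group on $\Omega_n$. The dihedral inverse monoid $\mathcal{DI}_n$ is the submonoid of $\mathcal{I}_n$ of all restrictions (to arbitrary subsets of $\Omega_n$) of elements of $\mathcal{D}_{2n}$. A sequence $(a_1,\ldots,a_t)$ ($t\geqslant0$) in $\Omega_n$ is cyclic if there is at most one index $i\in\{1,\ldots,t\}$ with $a_i>a_{i+1}$, where $a_{t+1}$ denotes $a_1$. An $\alpha\in\mathcal{I}_n$ with $\mathrm{Dom}(\alpha)=\{a_1<\cdots<a_t\}$ is orientation-preserving if $(a_1\alpha,\ldots,a_t\alpha)$ is cyclic. $\mathcal{OPDI}_n$ is the monoid of all orientation-preserving elements of $\mathcal{DI}_n$. A monoid $M$ is defined by a presentation $\langle D\mid Q\rangle$, where $Q\subseteq D^*\times D^*$, if $M\cong D^*/\rho_Q$, where $\rho_Q$ is the smallest congruence on the free monoid $D^*$ containing $Q$. Conventions: $1$ denotes the empty word; $e_a\cdots e_b$ denotes the product of the letters $e_k$, $a\leqslant k\leqslant b$, in increasing order of index, and is the empty word if $a>b$. A chain of $k$ equalities counts as $k$ relations. *)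

theory Defs
  imports Complex_Main "HOL-Algebra.Sym_Groups"
begin

section \<open>Partial permutations and the monoid OPDI\<close>

text \<open>Maps act on the right: the product of \<open>\<alpha>\<close> and \<open>\<beta>\<close> is first \<open>\<alpha>\<close>, then \<open>\<beta>\<close>.\<close>

definition sym_inv_monoid :: "nat \<Rightarrow> (nat \<rightharpoonup> nat) monoid" where
  "sym_inv_monoid n =
     \<lparr> carrier = {\<alpha>. dom \<alpha> \<subseteq> {1..n} \<and> ran \<alpha> \<subseteq> {1..n} \<and> inj_on \<alpha> (dom \<alpha>)},
       mult = (\<lambda>\<alpha> \<beta>. \<beta> \<circ>\<^sub>m \<alpha>),
       one = (\<lambda>i. if i \<in> {1..n} then Some i else None) \<rparr>"

text \<open>As elements of \<open>sym_group n\<close>, the permutations fix every number outside \<open>{1..n}\<close>.\<close>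

definition rot :: "nat \<Rightarrow> nat \<Rightarrow> nat" where
  "rot n i = (if i \<in> {1..n} then (if i = n then 1 else i + 1) else i)"

definition flip :: "nat \<Rightarrow> nat \<Rightarrow> nat" where
  "flip n i = (if i \<in> {1..n} then n + 1 - i else i)"

text \<open>The product of \<open>sym_group n\<close> is composition of functions, opposite to the product above;
  the subgroup generated by a set is the same for both orders.\<close>

definition dihedral :: "nat \<Rightarrow> (nat \<Rightarrow> nat) set" where
  "dihedral n = generate (sym_group n) {rot n, flip n}"

definition DI :: "nat \<Rightarrow> (nat \<rightharpoonup> nat) monoid" where
  "DI n = (sym_inv_monoid n)
     \<lparr> carrier := {(Some \<circ> p) |` A | p A. p \<in> dihedral n \<and> A \<subseteq> {1..n}} \<rparr>"

definition cyclic_seq :: "nat list \<Rightarrow> bool" where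
  "cyclic_seq as \<longleftrightarrow> card {i. i < length as \<and> as ! i > as ! (Suc i mod length as)} \<le> 1"

definition orientation_preserving :: "(nat \<rightharpoonup> nat) \<Rightarrow> bool" where
  "orientation_preserving \<alpha> \<longleftrightarrow>
     cyclic_seq (map (\<lambda>a. the (\<alpha> a)) (sorted_list_of_set (dom \<alpha>)))"

definition OPDI :: "nat \<Rightarrow> (nat \<rightharpoonup> nat) monoid" where
  "OPDI n = (DI n) \<lparr> carrier := {\<alpha> \<in> carrier (DI n). orientation_preserving \<alpha>} \<rparr>"


section \<open>Monoid presentations\<close>

definition free_monoid :: "'a set \<Rightarrow> 'a list monoid" where
  "free_monoid D = \<lparr> carrier = lists D, mult = (@), one = [] \<rparr>"

definition monoid_congruence :: "('a, 'b) monoid_scheme \<Rightarrow> 'a rel \<Rightarrow> bool" where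
  "monoid_congruence M r \<longleftrightarrow>
     equiv (carrier M) r \<and>
     (\<forall>a b c d. (a, b) \<in> r \<longrightarrow> (c, d) \<in> r \<longrightarrow> (a \<otimes>\<^bsub>M\<^esub> c, b \<otimes>\<^bsub>M\<^esub> d) \<in> r)"

definition generated_congruence :: "('a, 'b) monoid_scheme \<Rightarrow> 'a rel \<Rightarrow> 'a rel" where
  "generated_congruence M Q = \<Inter>{r. monoid_congruence M r \<and> Q \<subseteq> r}"

definition quotient_monoid :: "('a, 'b) monoid_scheme \<Rightarrow> 'a rel \<Rightarrow> 'a set monoid" where
  "quotient_monoid M r =
     \<lparr> carrier = carrier M // r,
       mult = (\<lambda>X Y. \<Union>x\<in>X. \<Union>y\<in>Y. r `` {x \<otimes>\<^bsub>M\<^esub> y}),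
       one = r `` {\<one>\<^bsub>M\<^esub>} \<rparr>"

definition defined_by_presentation ::
  "('a, 'b) monoid_scheme \<Rightarrow> 'c set \<Rightarrow> ('c list \<times> 'c list) set \<Rightarrow> bool" where
  "defined_by_presentation M D Q \<longleftrightarrow>
     Q \<subseteq> lists D \<times> lists D \<and>
     M \<cong> quotient_monoid (free_monoid D) (generated_congruence (free_monoid D) Q)"


section \<open>The alphabet and the relations\<close>

datatype letter = Lg | Le nat | Lx nat

definition alphabet :: "nat \<Rightarrow> nat \<Rightarrow> letter set" where
  "alphabet n m = {Lg} \<union> Le ` {1..n} \<union> Lx ` {1..m}"

abbreviation gpow :: "nat \<Rightarrow> letter list" where
  "gpow k \<equiv> replicate k Lg"

definition eprod :: "nat \<Rightarrow> nat \<Rightarrow> letter list" where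
  "eprod a b = map Le [a..<Suc b]"

text \<open>A chain \<open>u = v = w\<close> contributes the two pairs \<open>(u, v)\<close> and \<open>(v, w)\<close>.\<close>

definition relations :: "nat \<Rightarrow> nat \<Rightarrow> (letter list \<times> letter list) set" where
  "relations n m =
     {(gpow n, [])}
   \<union> {([Le i, Le i], [Le i]) | i. 1 \<le> i \<and> i \<le> n}
   \<union> {([Le i, Le j], [Le j, Le i]) | i j. 1 \<le> i \<and> i < j \<and> j \<le> n}
   \<union> {([Lg, Le 1], [Le n, Lg])}
   \<union> {([Lg, Le (i + 1)], [Le i, Lg]) | i. 1 \<le> i \<and> i \<le> n - 1}
   \<union> {([Lg] @ eprod 1 n, eprod 1 n)}
   \<union> {([Le 1, Lx i], [Lx i, Le 1]) | i. 1 \<le> i \<and> i \<le> m}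
   \<union> {([Lx i, Le 1], gpow (n - 2 * i) @ eprod 1 (n - i) @ eprod (n - i + 2) n)
        | i. 1 \<le> i \<and> i \<le> m}
   \<union> {([Lx i, Le j], [Lx i]) | i j. 1 \<le> i \<and> i \<le> m \<and> 2 \<le> j \<and> j \<le> n \<and> j \<noteq> n - i + 1}
   \<union> {([Le j, Lx i], [Lx i]) | i j. 1 \<le> i \<and> i \<le> m \<and> 2 \<le> j \<and> j \<le> n \<and> j \<noteq> i + 1}
   \<union> {([Lx i, Le (n - i + 1)], [Le (i + 1), Lx i]) | i. 1 \<le> i \<and> i \<le> m}
   \<union> {([Le (i + 1), Lx i], eprod 2 n) | i. 1 \<le> i \<and> i \<le> m}
   \<union> {(([Lx i] @ gpow i) @ ([Lx i] @ gpow i), eprod 2 i @ eprod (i + 2) n)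
        | i. 1 \<le> i \<and> i \<le> m}"

end

theory Submission
  imports Defs
begin

text \<open>Every word is congruent to a word \<open>e\<^sub>A g\<^sup>k\<close>, which acts as a rotation off the set \<open>A\<close>, or to a
  word \<open>g\<^sup>a x\<^sub>i g\<^sup>b\<close>, which acts as a reflection on two points at cyclic distance \<open>i \<le> m\<close>. The
  only delicate product is \<open>x\<^sub>i g\<^sup>b x\<^sub>j\<close>: if the image of \<open>x\<^sub>i g\<^sup>b\<close> is not the domain of \<open>x\<^sub>j\<close>, an
  idempotent killing an image point can be inserted in front of \<open>x\<^sub>j\<close>, and the word collapses to the
  first kind; otherwise \<open>i = j\<close>, \<open>b\<close> is congruent to \<open>i\<close> modulo \<open>n\<close>, and \<open>Q\<^sub>1\<^sub>0\<close> applies. Different normal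
  forms act differently, except that all rotations of the empty map agree, which is \<open>Q\<^sub>5\<close>. Finally, a
  reflection reverses the orientation of any three points, and on two points at distance \<open>n/2\<close> it
  agrees with a rotation, so the normal forms exhaust the monoid.\<close>

section \<open>Presentations and kernels\<close>

text \<open>The full relation on \<open>lists D\<close> is a congruence containing \<open>Q\<close>,
  so the intersection runs over a nonempty family and stays inside
  \<open>lists D \<times> lists D\<close>. The closure properties then pass to the
  intersection.\<close>

lemma monoid_congruence_generated:
  assumes "Q \<subseteq> lists D \<times> lists D"
  shows "monoid_congruence (free_monoid D) (generated_congruence (free_monoid D) Q)"
proof -
  let ?R = "{r. monoid_congruence (free_monoid D) r \<and> Q \<subseteq> r}"
  have top: "lists D \<times> lists D \<in> ?R"
    using assms by (auto simp: monoid_congruence_def free_monoid_def equiv_def refl_on_def sym_def trans_def)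
  have eq: "equiv (lists D) r" if "r \<in> ?R" for r
    using that by (auto simp: monoid_congruence_def free_monoid_def)
  have "equiv (lists D) (\<Inter>?R)"
  proof (rule equivI)
    show "\<Inter>?R \<subseteq> lists D \<times> lists D" using top by blast
    show "refl_on (lists D) (\<Inter>?R)"
      using eq by (fastforce simp: equiv_def refl_on_def)
    show "sym (\<Inter>?R)" using eq unfolding equiv_def sym_def by blast
    show "trans (\<Inter>?R)" using eq unfolding equiv_def trans_def by blast
  qed
  moreover have "\<forall>a b c d. (a, b) \<in> \<Inter>?R \<longrightarrow> (c, d) \<in> \<Inter>?R \<longrightarrow> (a @ c, b @ d) \<in> \<Inter>?R"
    by (auto simp: monoid_congruence_def free_monoid_def)
  ultimately show ?thesis
    by (simp add: generated_congruence_def monoid_congruence_def free_monoid_def)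
qed

text \<open>The kernel of a multiplicative map is a congruence, and it contains \<open>Q\<close> as
  soon as the map respects the relations.\<close>

lemma generated_congruence_subset_kernel:
  assumes Q: "Q \<subseteq> lists D \<times> lists D"
    and mult: "\<And>u v. u \<in> lists D \<Longrightarrow> v \<in> lists D \<Longrightarrow> f (u @ v) = f u \<otimes>\<^bsub>M\<^esub> f v"
    and rel: "\<And>u v. (u, v) \<in> Q \<Longrightarrow> f u = f v"
  shows "generated_congruence (free_monoid D) Q
           \<subseteq> {(u, v). u \<in> lists D \<and> v \<in> lists D \<and> f u = f v}" (is "_ \<subseteq> ?K")
proof -
  have "equiv (lists D) ?K"
    by (rule equivI) (auto simp: refl_on_def sym_def trans_def)
  moreover have "(a @ c, b @ d) \<in> ?K" if "(a, b) \<in> ?K" "(c, d) \<in> ?K" for a b c d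
    using that mult by (auto simp del: append_in_lists_conv simp: append_in_lists_conv)
  ultimately have "monoid_congruence (free_monoid D) ?K"
    by (simp add: monoid_congruence_def free_monoid_def)
  moreover have "Q \<subseteq> ?K" using Q rel by auto
  ultimately show ?thesis unfolding generated_congruence_def by blast
qed

text \<open>By \<open>ker\<close> and the previous lemma, the generated congruence is exactly the
  kernel of \<open>f\<close>, so its classes are the fibres of \<open>f\<close>. The isomorphism
  sends an element of \<open>M\<close> to its fibre.\<close>

lemma defined_by_presentationI:
  assumes Q: "Q \<subseteq> lists D \<times> lists D"
    and mult: "\<And>u v. u \<in> lists D \<Longrightarrow> v \<in> lists D \<Longrightarrow> f (u @ v) = f u \<otimes>\<^bsub>M\<^esub> f v"
    and rel: "\<And>u v. (u, v) \<in> Q \<Longrightarrow> f u = f v"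
    and img: "f ` lists D = carrier M"
    and ker: "\<And>u v. u \<in> lists D \<Longrightarrow> v \<in> lists D \<Longrightarrow> f u = f v
                \<Longrightarrow> (u, v) \<in> generated_congruence (free_monoid D) Q"
  shows "defined_by_presentation M D Q"
proof -
  let ?r = "generated_congruence (free_monoid D) Q"
  let ?q = "quotient_monoid (free_monoid D) ?r"
  have r: "?r = {(u, v). u \<in> lists D \<and> v \<in> lists D \<and> f u = f v}"
    using generated_congruence_subset_kernel[of Q D f M, OF Q mult rel] ker
    by blast
  define h where "h x = {w \<in> lists D. f w = x}" for x
  have cls: "?r `` {u} = h (f u)" if "u \<in> lists D" for u
    using that by (auto simp: r h_def)
  have carr: "carrier ?q = h ` carrier M"
  proof -
    have "carrier ?q = (\<lambda>u. ?r `` {u}) ` lists D"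
      by (auto simp: quotient_monoid_def free_monoid_def quotient_def)
    also have "\<dots> = (\<lambda>u. h (f u)) ` lists D" using cls by (intro image_cong) auto
    finally show ?thesis by (simp add: img[symmetric] image_image)
  qed
  have inj: "inj_on h (carrier M)"
  proof (rule inj_onI)
    fix x y assume "x \<in> carrier M" "y \<in> carrier M" and e: "h x = h y"
    then obtain u where u: "u \<in> lists D" "f u = x" using img by (metis imageE)
    hence "u \<in> h y" using e by (auto simp: h_def)
    thus "x = y" using u by (auto simp: h_def)
  qed
  have "h \<in> hom M ?q"
  proof (rule homI)
    fix x assume "x \<in> carrier M" thus "h x \<in> carrier ?q" by (simp add: carr)
  next
    fix x y assume "x \<in> carrier M" "y \<in> carrier M"
    then obtain u v where u: "u \<in> lists D" "f u = x" and v: "v \<in> lists D" "f v = y"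
      using img by (metis imageE)
    have "h x \<otimes>\<^bsub>?q\<^esub> h y = (\<Union>a\<in>h x. \<Union>b\<in>h y. ?r `` {a @ b})"
      by (simp add: quotient_monoid_def free_monoid_def)
    also have "\<dots> = (\<Union>a\<in>h x. \<Union>b\<in>h y. h (x \<otimes>\<^bsub>M\<^esub> y))"
      by (intro SUP_cong refl) (subst cls, auto simp: h_def mult)
    also have "\<dots> = h (x \<otimes>\<^bsub>M\<^esub> y)"
      using u v by (auto simp: h_def)
    finally show "h (x \<otimes>\<^bsub>M\<^esub> y) = h x \<otimes>\<^bsub>?q\<^esub> h y" ..
  qed
  hence "h \<in> iso M ?q" using inj carr by (auto simp: iso_def bij_betw_def)
  thus ?thesis using Q by (auto simp: defined_by_presentation_def is_iso_def)
qed

section \<open>Points modulo n\<close>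

locale opdi =
  fixes n m :: nat
  assumes n4: "4 \<le> n" and m_eq: "m = (n - 1) div 2"
begin

text \<open>The representative of \<open>t\<close> modulo \<open>n\<close> in \<open>{1..n}\<close>; it turns rotations and reflections into
  the maps \<open>t + k\<close> and \<open>s - t\<close> on integers.\<close>

definition pt :: "int \<Rightarrow> nat" where
  "pt t = nat ((t - 1) mod int n) + 1"

lemma pt_in: "pt t \<in> {1..n}"
proof -
  have "(t - 1) mod int n < int n" using n4 by simp
  thus ?thesis by (simp add: pt_def nat_less_iff Suc_le_eq) (use n4 in linarith)
qed

lemma pt_ge_le [simp]: "1 \<le> pt t" "Suc 0 \<le> pt t" "pt t \<le> n" "0 < pt t"
  using pt_in[of t] by auto

lemma pt_eq_iff: "pt s = pt t \<longleftrightarrow> int n dvd s - t"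
proof -
  have "pt s = pt t \<longleftrightarrow> (s - 1) mod int n = (t - 1) mod int n"
    using n4 by (simp add: pt_def nat_eq_iff)
  thus ?thesis by (simp add: mod_eq_dvd_iff)
qed

lemma pt_of_nat [simp]: "j \<in> {1..n} \<Longrightarrow> pt (int j) = j"
  by (simp add: pt_def nat_diff_distrib)

lemma pt_eq_nat_iff: "j \<in> {1..n} \<Longrightarrow> pt s = j \<longleftrightarrow> int n dvd s - int j"
  using pt_eq_iff[of s "int j"] by simp

text \<open>Naming the multiple of \<open>n\<close> lets a representative be replaced by the
  original integer inside larger sums.\<close>

lemma int_pt: "\<exists>q. int (pt t) = t + q * int n"
proof -
  have "pt (int (pt t)) = pt t" using pt_in by simp
  hence "int n dvd int (pt t) - t" by (rule pt_eq_iff[THEN iffD1])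
  then obtain q where "int (pt t) - t = int n * q" ..
  thus ?thesis by (intro exI[of _ q]) (simp add: algebra_simps)
qed

lemma pt_pt_add [simp]: "pt (int (pt t) + s) = pt (t + s)"
  using int_pt[of t] by (auto simp: pt_eq_iff)

lemma pt_minus_pt [simp]: "pt (s - int (pt t)) = pt (s - t)"
  using int_pt[of t] by (auto simp: pt_eq_iff)

lemma pt_pt [simp]: "pt (int (pt t)) = pt t" using pt_in by simp

text \<open>The bound \<open>2 * i < n\<close> makes the two ways round the circle, \<open>i\<close>
  and \<open>n - i\<close>, differ; everything that separates reflections from rotations rests on
  it.\<close>

lemma x_range: "i \<in> {1..m} \<Longrightarrow> 1 \<le> i \<and> 2 * i < n"
  using m_eq n4 by auto

lemma small_dvd: "int n dvd t \<Longrightarrow> \<bar>t\<bar> < int n \<Longrightarrow> t = 0"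
  using dvd_imp_le_int[of t "int n"] by fastforce


section \<open>Words modulo the relations\<close>

abbreviation "D \<equiv> alphabet n m"

abbreviation "R \<equiv> generated_congruence (free_monoid D) (relations n m)"

text \<open>Outside \<open>lists D\<close> all classes are empty; this makes the relation a congruence on all
  words, without side conditions.\<close>

definition weq :: "letter list \<Rightarrow> letter list \<Rightarrow> bool" (infix "\<approx>" 50) where
  "u \<approx> v \<longleftrightarrow> R `` {u} = R `` {v}"

lemma alphabet_simps [simp]:
  "Lg \<in> D" "Le j \<in> D \<longleftrightarrow> j \<in> {1..n}" "Lx i \<in> D \<longleftrightarrow> i \<in> {1..m}"
  by (auto simp: alphabet_def)

lemma set_eprod [simp]: "set (eprod a b) = Le ` {a..b}"
  by (auto simp: eprod_def)

lemma gpow_lists [simp]: "gpow k \<in> lists D"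
  by (auto simp: in_lists_conv_set)

lemma eprod_lists [simp]: "1 \<le> a \<Longrightarrow> b \<le> n \<Longrightarrow> eprod a b \<in> lists D"
  by (auto simp: in_lists_conv_set)

lemma relations_lists: "relations n m \<subseteq> lists D \<times> lists D"
proof -
  have "m < n" using m_eq n4 by auto
  thus ?thesis using n4 unfolding relations_def by fastforce
qed

lemma R_equiv: "equiv (lists D) R"
  and R_append: "(a, b) \<in> R \<Longrightarrow> (c, d) \<in> R \<Longrightarrow> (a @ c, b @ d) \<in> R"
  using monoid_congruence_generated[OF relations_lists]
  by (auto simp: monoid_congruence_def free_monoid_def)

lemma R_lists: "(u, v) \<in> R \<Longrightarrow> u \<in> lists D \<and> v \<in> lists D"
  using R_equiv equiv_type by blast

lemma weq_iff: "u \<in> lists D \<Longrightarrow> u \<approx> v \<longleftrightarrow> (u, v) \<in> R"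
proof
  assume u: "u \<in> lists D" and "u \<approx> v"
  moreover have "u \<in> R `` {u}" using equiv_class_self[OF R_equiv u] .
  ultimately have "(v, u) \<in> R" by (auto simp: weq_def)
  thus "(u, v) \<in> R" using R_equiv by (meson equivE symE)
next
  assume "(u, v) \<in> R"
  thus "u \<approx> v" unfolding weq_def by (rule equiv_class_eq[OF R_equiv])
qed

lemma weq_lists: assumes "u \<approx> v" shows "u \<in> lists D \<longleftrightarrow> v \<in> lists D"
proof -
  have "w \<in> lists D \<longleftrightarrow> R `` {w} \<noteq> {}" for w
    using equiv_class_self[OF R_equiv, of w] R_lists[of w] by blast
  thus ?thesis using assms by (simp add: weq_def)
qed

lemma weq_refl [simp]: "u \<approx> u"
  by (simp add: weq_def)

lemma weq_sym: "u \<approx> v \<Longrightarrow> v \<approx> u"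
  by (simp add: weq_def)

lemma weq_trans [trans]: "u \<approx> v \<Longrightarrow> v \<approx> w \<Longrightarrow> u \<approx> w"
  by (simp add: weq_def)

lemma weq_append: assumes "u \<approx> u'" "v \<approx> v'" shows "u @ v \<approx> u' @ v'"
proof (cases "u \<in> lists D \<and> v \<in> lists D")
  case True
  hence "(u @ v, u' @ v') \<in> R" using assms R_append by (simp add: weq_iff)
  thus ?thesis using True by (simp add: weq_iff)
next
  case False
  hence "u @ v \<notin> lists D" "u' @ v' \<notin> lists D"
    using weq_lists[OF assms(1)] weq_lists[OF assms(2)] by auto
  hence "R `` {u @ v} = {}" "R `` {u' @ v'} = {}" using R_lists by blast+
  thus ?thesis by (simp add: weq_def)
qed

lemma weq_left: "v \<approx> v' \<Longrightarrow> u @ v \<approx> u @ v'"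
  by (simp add: weq_append)

lemma weq_right: "u \<approx> u' \<Longrightarrow> u @ v \<approx> u' @ v"
  by (simp add: weq_append)

section \<open>The defining relations as equivalences of words\<close>

lemma weq_relations: "(u, v) \<in> relations n m \<Longrightarrow> u \<approx> v"
proof -
  assume a: "(u, v) \<in> relations n m"
  hence "(u, v) \<in> R" by (auto simp: generated_congruence_def)
  moreover have "u \<in> lists D" using a relations_lists by blast
  ultimately show ?thesis by (simp add: weq_iff)
qed

lemma gpow_n: "gpow n \<approx> []"
  by (rule weq_relations) (simp add: relations_def)

lemma Le_idem: "j \<in> {1..n} \<Longrightarrow> [Le j, Le j] \<approx> [Le j]"
  by (rule weq_relations) (auto simp: relations_def)

lemma Le_commute:
  assumes "i \<in> {1..n}" "j \<in> {1..n}"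
  shows "[Le i, Le j] \<approx> [Le j, Le i]"
proof -
  have *: "[Le i, Le j] \<approx> [Le j, Le i]" if "1 \<le> i" "i < j" "j \<le> n" for i j
    by (rule weq_relations) (use that in \<open>auto simp: relations_def\<close>)
  show ?thesis using *[of i j] *[of j i] assms weq_sym
    by (cases i j rule: linorder_cases) auto
qed

text \<open>Both cases of Q4 at once: with indices modulo \<open>n\<close>, the relation for
  \<open>ge\<^sub>1\<close> is the wrap-around case \<open>pt t = n\<close>.\<close>

lemma Lg_Le: "[Lg, Le (pt (t + 1))] \<approx> [Le (pt t), Lg]"
proof (cases "pt t = n")
  case True
  have "pt (t + 1) = pt (int n + 1)" using pt_pt_add[of t 1] True by simp
  also have "\<dots> = 1" using n4 by (simp add: pt_eq_nat_iff)
  finally show ?thesis unfolding True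
    by (intro weq_relations) (simp add: relations_def)
next
  case False
  hence l: "pt t + 1 \<in> {1..n}" using pt_in[of t] unfolding atLeastAtMost_iff by linarith
  have "pt (t + 1) = pt (int (pt t + 1))" using pt_pt_add[of t 1] by (simp add: add.commute)
  also have "\<dots> = pt t + 1" using l by (rule pt_of_nat)
  finally have "pt (t + 1) = pt t + 1" .
  thus ?thesis using l pt_in[of t]
    by (intro weq_relations) (auto simp: relations_def)
qed

lemma Lg_eprod: "[Lg] @ eprod 1 n \<approx> eprod 1 n"
  by (rule weq_relations) (simp add: relations_def)

context
  fixes i assumes i: "i \<in> {1..m}"
begin

lemma Le_1_Lx: "[Le 1, Lx i] \<approx> [Lx i, Le 1]"
  by (rule weq_relations) (use i in \<open>auto simp: relations_def\<close>)

lemma Lx_Le_1: "[Lx i, Le 1] \<approx> gpow (n - 2 * i) @ eprod 1 (n - i) @ eprod (n - i + 2) n"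
  by (rule weq_relations) (use i in \<open>auto simp: relations_def\<close>)

lemma Lx_Le: "j \<in> {1..n} \<Longrightarrow> j \<noteq> 1 \<Longrightarrow> j \<noteq> n - i + 1 \<Longrightarrow> [Lx i, Le j] \<approx> [Lx i]"
  by (rule weq_relations) (use i in \<open>auto simp: relations_def\<close>)

lemma Le_Lx: "j \<in> {1..n} \<Longrightarrow> j \<noteq> 1 \<Longrightarrow> j \<noteq> i + 1 \<Longrightarrow> [Le j, Lx i] \<approx> [Lx i]"
  by (rule weq_relations) (use i in \<open>auto simp: relations_def\<close>)

lemma Lx_Le_last: "[Lx i, Le (n - i + 1)] \<approx> [Le (i + 1), Lx i]"
  by (rule weq_relations) (use i in \<open>auto simp: relations_def\<close>)

lemma Le_Suc_Lx: "[Le (i + 1), Lx i] \<approx> eprod 2 n"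
  by (rule weq_relations) (use i in \<open>auto simp: relations_def\<close>)

lemma Lx_square: "([Lx i] @ gpow i) @ [Lx i] @ gpow i \<approx> eprod 2 i @ eprod (i + 2) n"
  by (rule weq_relations) (use i in \<open>auto simp: relations_def\<close>)

end

lemma gpow_add_mult: "gpow (k + q * n) \<approx> gpow k"
proof (induction q)
  case (Suc q)
  have "gpow (k + Suc q * n) = gpow (k + q * n) @ gpow n"
    by (simp add: replicate_add[symmetric] algebra_simps)
  also have "\<dots> \<approx> gpow k @ []" by (intro weq_append Suc gpow_n)
  finally show ?case by simp
qed simp

text \<open>By Q1 both powers reduce to the power with the common remainder modulo \<open>n\<close>
  as exponent.\<close>

lemma gpow_cong: assumes "int n dvd int a - int b" shows "gpow a \<approx> gpow b"
proof -
  have *: "gpow k \<approx> gpow (k mod n)" for k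
    using gpow_add_mult[of "k mod n" "k div n"] by simp
  have "a mod n = b mod n"
    using assms by (metis mod_eq_dvd_iff of_nat_eq_iff zmod_int)
  thus ?thesis using *[of a] *[of b] weq_sym weq_trans by metis
qed

section \<open>Products of idempotents\<close>

lemma Le_commute_list:
  "j \<in> {1..n} \<Longrightarrow> set as \<subseteq> {1..n} \<Longrightarrow> [Le j] @ map Le as \<approx> map Le as @ [Le j]"
proof (induction as)
  case (Cons a as)
  have "[Le j] @ map Le (a # as) = [Le j, Le a] @ map Le as" by simp
  also have "\<dots> \<approx> [Le a, Le j] @ map Le as"
    using Cons.prems by (intro weq_right Le_commute) auto
  also have "\<dots> = [Le a] @ ([Le j] @ map Le as)" by simp
  also have "\<dots> \<approx> [Le a] @ (map Le as @ [Le j])" using Cons by (intro weq_left) auto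
  finally show ?case by simp
qed simp

lemma map_Le_commute:
  "set bs \<subseteq> {1..n} \<Longrightarrow> set as \<subseteq> {1..n} \<Longrightarrow> map Le bs @ map Le as \<approx> map Le as @ map Le bs"
proof (induction bs)
  case (Cons b bs)
  have "map Le (b # bs) @ map Le as = [Le b] @ (map Le bs @ map Le as)" by simp
  also have "\<dots> \<approx> [Le b] @ (map Le as @ map Le bs)" using Cons by (intro weq_left) auto
  also have "\<dots> = ([Le b] @ map Le as) @ map Le bs" by simp
  also have "\<dots> \<approx> (map Le as @ [Le b]) @ map Le bs"
    using Cons.prems by (intro weq_right Le_commute_list) auto
  finally show ?case by simp
qed simp

lemma Le_absorb: "j \<in> set as \<Longrightarrow> set as \<subseteq> {1..n} \<Longrightarrow> [Le j] @ map Le as \<approx> map Le as"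
proof (induction as)
  case (Cons a as)
  show ?case
  proof (cases "j = a")
    case True
    have "[Le j] @ map Le (a # as) = [Le a, Le a] @ map Le as" using True by simp
    also have "\<dots> \<approx> [Le a] @ map Le as" using Cons.prems by (intro weq_right Le_idem) auto
    finally show ?thesis by simp
  next
    case False
    have "[Le j] @ map Le (a # as) = [Le j, Le a] @ map Le as" by simp
    also have "\<dots> \<approx> [Le a, Le j] @ map Le as"
      using Cons.prems by (intro weq_right Le_commute) auto
    also have "\<dots> = [Le a] @ ([Le j] @ map Le as)" by simp
    also have "\<dots> \<approx> [Le a] @ map Le as" using Cons False by (intro weq_left) auto
    finally show ?thesis by simp
  qed
qed simp

lemma map_Le_absorb:
  "set bs \<subseteq> set as \<Longrightarrow> set as \<subseteq> {1..n} \<Longrightarrow> map Le bs @ map Le as \<approx> map Le as"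
proof (induction bs)
  case (Cons b bs)
  have "map Le (b # bs) @ map Le as = [Le b] @ (map Le bs @ map Le as)" by simp
  also have "\<dots> \<approx> [Le b] @ map Le as" using Cons by (intro weq_left) auto
  also have "\<dots> \<approx> map Le as" using Cons.prems by (intro Le_absorb) auto
  finally show ?case .
qed simp

text \<open>Commuting idempotents form a semilattice: each product absorbs the other, so only the
  set of indices matters.\<close>

lemma map_Le_cong:
  assumes "set as = set bs" "set as \<subseteq> {1..n}"
  shows "map Le as \<approx> map Le bs"
proof -
  have "map Le as \<approx> map Le bs @ map Le as" using assms by (intro weq_sym[OF map_Le_absorb]) auto
  also have "\<dots> \<approx> map Le as @ map Le bs" using assms by (intro map_Le_commute) auto
  also have "\<dots> \<approx> map Le bs" using assms by (intro map_Le_absorb) auto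
  finally show ?thesis .
qed

text \<open>Integer indices turn conjugation by powers of \<open>g\<close> into plain subtraction,
  with no case distinction at the wrap-around.\<close>

definition eword :: "int list \<Rightarrow> letter list" where
  "eword ts = map (\<lambda>t. Le (pt t)) ts"

lemma eword_simps [simp]:
  "eword [] = []" "eword (t # ts) = Le (pt t) # eword ts" "eword (ts @ ss) = eword ts @ eword ss"
  by (simp_all add: eword_def)

lemma eword_map_Le: "eword ts = map Le (map pt ts)"
  by (simp add: eword_def)

lemma map_Le_eword: "set as \<subseteq> {1..n} \<Longrightarrow> map Le as = eword (map int as)"
  by (induction as) auto

text \<open>Iterated Q4: passing an idempotent to the left through \<open>g\<^sup>k\<close> lowers
  its index by \<open>k\<close> modulo \<open>n\<close>.\<close>

lemma gpow_Le: "gpow k @ [Le (pt t)] \<approx> [Le (pt (t - int k))] @ gpow k"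
proof (induction k arbitrary: t)
  case (Suc k)
  have "gpow (Suc k) @ [Le (pt t)] = [Lg] @ (gpow k @ [Le (pt t)])" by simp
  also have "\<dots> \<approx> [Lg] @ ([Le (pt (t - int k))] @ gpow k)" by (intro weq_left Suc)
  also have "\<dots> = [Lg, Le (pt ((t - int (Suc k)) + 1))] @ gpow k" by simp
  also have "\<dots> \<approx> [Le (pt (t - int (Suc k))), Lg] @ gpow k" by (intro weq_right Lg_Le)
  finally show ?case by simp
qed simp

lemma gpow_eword: "gpow k @ eword ts \<approx> eword (map (\<lambda>t. t - int k) ts) @ gpow k"
proof (induction ts)
  case (Cons t ts)
  have "gpow k @ eword (t # ts) = (gpow k @ [Le (pt t)]) @ eword ts" by simp
  also have "\<dots> \<approx> ([Le (pt (t - int k))] @ gpow k) @ eword ts" by (intro weq_right gpow_Le)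
  also have "\<dots> = [Le (pt (t - int k))] @ (gpow k @ eword ts)" by simp
  also have "\<dots> \<approx> [Le (pt (t - int k))] @ (eword (map (\<lambda>t. t - int k) ts) @ gpow k)"
    by (intro weq_left Cons)
  finally show ?case by simp
qed simp

section \<open>Normal forms\<close>

definition rot_form :: "letter list \<Rightarrow> bool" where
  "rot_form w \<longleftrightarrow> (\<exists>ts k. w \<approx> eword ts @ gpow k)"

definition refl_form :: "letter list \<Rightarrow> bool" where
  "refl_form w \<longleftrightarrow> (\<exists>a i b. i \<in> {1..m} \<and> w \<approx> gpow a @ [Lx i] @ gpow b)"

lemma rot_form_cong: "u \<approx> v \<Longrightarrow> rot_form v \<Longrightarrow> rot_form u"
  unfolding rot_form_def using weq_trans by blast

lemma refl_form_cong: "u \<approx> v \<Longrightarrow> refl_form v \<Longrightarrow> refl_form u"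
  unfolding refl_form_def using weq_trans by blast

lemma rot_form_append: assumes "rot_form u" "rot_form v" shows "rot_form (u @ v)"
proof -
  obtain ts k ss l where u: "u \<approx> eword ts @ gpow k" and v: "v \<approx> eword ss @ gpow l"
    using assms by (auto simp: rot_form_def)
  have "u @ v \<approx> (eword ts @ gpow k) @ (eword ss @ gpow l)" by (intro weq_append u v)
  also have "\<dots> = eword ts @ (gpow k @ eword ss) @ gpow l" by simp
  also have "\<dots> \<approx> eword ts @ (eword (map (\<lambda>t. t - int k) ss) @ gpow k) @ gpow l"
    by (intro weq_left weq_right gpow_eword)
  also have "\<dots> = eword (ts @ map (\<lambda>t. t - int k) ss) @ gpow (k + l)"
    by (simp add: replicate_add)
  finally show ?thesis unfolding rot_form_def by blast
qed

lemma rot_form_gpow: "rot_form (gpow k)"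
  unfolding rot_form_def by (rule exI[of _ "[]"]) (auto intro: exI[of _ k])

lemma rot_form_map_Le: "set as \<subseteq> {1..n} \<Longrightarrow> rot_form (map Le as)"
  unfolding rot_form_def by (rule exI[of _ "map int as"], rule exI[of _ 0]) (simp add: map_Le_eword)

lemma rot_form_Le: "j \<in> {1..n} \<Longrightarrow> rot_form [Le j]"
  using rot_form_map_Le[of "[j]"] by simp

lemma rot_form_eprod: "1 \<le> a \<Longrightarrow> b \<le> n \<Longrightarrow> rot_form (eprod a b)"
  unfolding eprod_def by (rule rot_form_map_Le) auto

section \<open>Appending a letter to a normal form\<close>

lemma rot_form_Lx_Le_1: "i \<in> {1..m} \<Longrightarrow> rot_form [Lx i, Le 1]"
  by (rule rot_form_cong[OF Lx_Le_1]) (auto intro!: rot_form_append rot_form_gpow rot_form_eprod)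

text \<open>The points \<open>1\<close> and \<open>i + 1\<close> form the domain of
  \<open>x\<^sub>i\<close>. Killing one of them leaves a map of rank one, which Q6 and Q9 rewrite
  without \<open>x\<^sub>i\<close>.\<close>

lemma rot_form_Le_Lx:
  assumes i: "i \<in> {1..m}" and j: "j = 1 \<or> j = i + 1"
  shows "rot_form [Le j, Lx i]"
proof (cases "j = 1")
  case True
  thus ?thesis using rot_form_cong[OF Le_1_Lx[OF i] rot_form_Lx_Le_1[OF i]] by simp
next
  case False
  thus ?thesis using j rot_form_cong[OF Le_Suc_Lx[OF i]] rot_form_eprod[of 2 n] by simp
qed

lemma rot_form_Lx_Le:
  assumes i: "i \<in> {1..m}" and j: "j = 1 \<or> j = n - i + 1"
  shows "rot_form [Lx i, Le j]"
  using j rot_form_Lx_Le_1[OF i] rot_form_cong[OF Lx_Le_last[OF i]] rot_form_Le_Lx[OF i] by auto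

text \<open>Induction from the right, because the idempotent next to \<open>x\<^sub>i\<close> acts
  first: it is absorbed by Q8 or it destroys \<open>x\<^sub>i\<close>.\<close>

lemma map_Le_Lx:
  assumes i: "i \<in> {1..m}"
  shows "set as \<subseteq> {1..n} \<Longrightarrow> rot_form (map Le as @ [Lx i]) \<or> map Le as @ [Lx i] \<approx> [Lx i]"
proof (induction as rule: rev_induct)
  case (snoc j as)
  have eq: "map Le (as @ [j]) @ [Lx i] = map Le as @ [Le j, Lx i]" by simp
  show ?case
  proof (cases "j = 1 \<or> j = i + 1")
    case True
    thus ?thesis unfolding eq
      using snoc.prems rot_form_append[OF rot_form_map_Le rot_form_Le_Lx[OF i]] by auto
  next
    case False
    hence "[Le j, Lx i] \<approx> [Lx i]" using snoc.prems i by (intro Le_Lx) auto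
    hence "map Le (as @ [j]) @ [Lx i] \<approx> map Le as @ [Lx i]"
      unfolding eq by (rule weq_left)
    thus ?thesis using snoc rot_form_cong weq_trans by auto
  qed
qed simp

lemma rot_form_Lx:
  assumes i: "i \<in> {1..m}" and u: "rot_form u"
  shows "rot_form (u @ [Lx i]) \<or> refl_form (u @ [Lx i])"
proof -
  obtain ts k where u: "u \<approx> eword ts @ gpow k" using u by (auto simp: rot_form_def)
  \<comment> \<open>The indices are raised by \<open>k\<close> in advance, so that the power of
    \<open>g\<close> can move in front and leave the idempotents adjacent to
    \<open>x\<^sub>i\<close>.\<close>
  define as where "as = map pt (map (\<lambda>t. t + int k) ts)"
  have "eword ts @ gpow k \<approx> gpow k @ map Le as"
    using weq_sym[OF gpow_eword[of k "map (\<lambda>t. t + int k) ts"]]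
    by (simp add: as_def eword_map_Le comp_def)
  hence "u \<approx> gpow k @ map Le as" using u weq_trans by blast
  hence eq: "u @ [Lx i] \<approx> gpow k @ (map Le as @ [Lx i])" using weq_right by fastforce
  have "set as \<subseteq> {1..n}" by (auto simp: as_def)
  from map_Le_Lx[OF i this] show ?thesis
  proof
    assume "rot_form (map Le as @ [Lx i])"
    hence "rot_form (gpow k @ (map Le as @ [Lx i]))" by (rule rot_form_append[OF rot_form_gpow])
    thus ?thesis using rot_form_cong[OF eq] by simp
  next
    assume "map Le as @ [Lx i] \<approx> [Lx i]"
    hence "u @ [Lx i] \<approx> gpow k @ [Lx i] @ gpow 0"
      using weq_trans[OF eq weq_left] by simp
    thus ?thesis unfolding refl_form_def using i by blast
  qed
qed

lemma refl_form_Le: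
  assumes j: "j \<in> {1..n}" and u: "refl_form u"
  shows "rot_form (u @ [Le j]) \<or> refl_form (u @ [Le j])"
proof -
  obtain a i b where i: "i \<in> {1..m}" and u: "u \<approx> gpow a @ [Lx i] @ gpow b"
    using u by (auto simp: refl_form_def)
  \<comment> \<open>The index that \<open>e\<^sub>j\<close> acquires on its way left through
    \<open>g\<^sup>b\<close>, where it meets \<open>x\<^sub>i\<close>. The image of
    \<open>x\<^sub>i\<close> consists of \<open>1\<close> and \<open>n - i + 1\<close>.\<close>
  define s where "s = pt (int j - int b)"
  have s: "s \<in> {1..n}" unfolding s_def by (rule pt_in)
  have "u @ [Le j] \<approx> (gpow a @ [Lx i] @ gpow b) @ [Le (pt (int j))]"
    using weq_right[OF u] j by simp
  also have "\<dots> = (gpow a @ [Lx i]) @ (gpow b @ [Le (pt (int j))])" by simp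
  also have "\<dots> \<approx> (gpow a @ [Lx i]) @ ([Le s] @ gpow b)"
    unfolding s_def by (intro weq_left gpow_Le)
  finally have eq: "u @ [Le j] \<approx> gpow a @ [Lx i, Le s] @ gpow b" by simp
  show ?thesis
  proof (cases "s = 1 \<or> s = n - i + 1")
    case True
    hence "rot_form (gpow a @ [Lx i, Le s] @ gpow b)"
      by (intro rot_form_append rot_form_gpow rot_form_Lx_Le i)
    thus ?thesis using rot_form_cong[OF eq] by simp
  next
    case False
    hence "[Lx i, Le s] \<approx> [Lx i]" using s i by (intro Lx_Le) auto
    hence "gpow a @ [Lx i, Le s] @ gpow b \<approx> gpow a @ [Lx i] @ gpow b"
      by (intro weq_left weq_right)
    with eq have "u @ [Le j] \<approx> gpow a @ [Lx i] @ gpow b" by (rule weq_trans)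
    thus ?thesis unfolding refl_form_def using i by blast
  qed
qed

lemma refl_form_Lx:
  assumes j: "j \<in> {1..m}" and u: "refl_form u"
  shows "rot_form (u @ [Lx j]) \<or> refl_form (u @ [Lx j])"
proof -
  obtain a i b where i: "i \<in> {1..m}" and u: "u \<approx> gpow a @ [Lx i] @ gpow b"
    using u by (auto simp: refl_form_def)
  have ij: "1 \<le> i" "2 * i < n" "1 \<le> j" "2 * j < n" using x_range i j by auto
  have last: "pt (1 - int i) = n - i + 1" using ij by (subst pt_eq_nat_iff) auto
  \<comment> \<open>\<open>1 + b\<close> and \<open>1 - i + b\<close> are the image points of \<open>x\<^sub>i g\<^sup>b\<close>, and \<open>{1, j + 1}\<close> is the domain of
    \<open>x\<^sub>j\<close>.\<close>
  have out: ?thesis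
    if t: "t = 1 \<or> t = 1 - int i" and o: "pt (t + int b) \<noteq> 1" "pt (t + int b) \<noteq> j + 1" for t
  proof -
    have tt: "pt t = 1 \<or> pt t = n - i + 1" using t last pt_of_nat[of 1] n4 by auto
    have "u @ [Lx j] \<approx> (gpow a @ [Lx i] @ gpow b) @ [Lx j]" by (intro weq_right u)
    also have "\<dots> \<approx> (gpow a @ [Lx i] @ gpow b) @ [Le (pt (t + int b)), Lx j]"
      using o pt_in j by (intro weq_left weq_sym[OF Le_Lx]) auto
    \<comment> \<open>The inserted idempotent travels back through \<open>g\<^sup>b\<close> and hits
      the image point \<open>pt t\<close> of \<open>x\<^sub>i\<close>, so \<open>x\<^sub>i\<close>
      disappears.\<close>
    also have "\<dots> = (gpow a @ [Lx i]) @ (gpow b @ [Le (pt (t + int b))]) @ [Lx j]" by simp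
    also have "\<dots> \<approx> (gpow a @ [Lx i]) @ ([Le (pt (t + int b - int b))] @ gpow b) @ [Lx j]"
      by (intro weq_left weq_right gpow_Le)
    finally have "u @ [Lx j] \<approx> (gpow a @ [Lx i, Le (pt t)] @ gpow b) @ [Lx j]" by simp
    moreover have "rot_form (gpow a @ [Lx i, Le (pt t)] @ gpow b)"
      by (intro rot_form_append rot_form_gpow rot_form_Lx_Le i tt)
    ultimately show ?thesis
      using rot_form_Lx[OF j] rot_form_cong refl_form_cong by blast
  qed
  show ?thesis
  proof (cases "pt (1 + int b) = j + 1 \<and> pt (1 - int i + int b) = 1")
    case True
    hence d: "int n dvd int b - int j" "int n dvd int b - int i"
      using ij n4 by (auto simp: pt_eq_nat_iff algebra_simps)
    have "int n dvd (int b - int j) - (int b - int i)" using d by (rule dvd_diff)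
    hence "int n dvd int i - int j" by simp
    hence "i = j" using small_dvd[of "int i - int j"] ij by simp
    have "u @ [Lx j] \<approx> (gpow a @ [Lx i] @ gpow b) @ [Lx i]"
      using weq_right[OF u] \<open>i = j\<close> by simp
    also have "\<dots> = (gpow a @ [Lx i]) @ (gpow b @ ([Lx i] @ []))" by simp
    \<comment> \<open>Q10 needs a second factor \<open>g\<^sup>i\<close>; it is split off from an
      appended \<open>g\<^sup>n\<close>, leaving \<open>g\<close> to the power
      \<open>n - i\<close>.\<close>
    also have "\<dots> \<approx> (gpow a @ [Lx i]) @ (gpow i @ ([Lx i] @ gpow n))"
      using weq_sym[OF gpow_n] d by (intro weq_append gpow_cong weq_refl) auto
    also have "gpow n = gpow i @ gpow (n - i)" using ij by (simp flip: replicate_add)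
    also have "(gpow a @ [Lx i]) @ (gpow i @ ([Lx i] @ \<dots>)) =
               gpow a @ (([Lx i] @ gpow i) @ [Lx i] @ gpow i) @ gpow (n - i)" by simp
    also have "\<dots> \<approx> gpow a @ (eprod 2 i @ eprod (i + 2) n) @ gpow (n - i)"
      by (intro weq_left weq_right Lx_square i)
    finally have "u @ [Lx j] \<approx> \<dots>" .
    moreover have "rot_form (gpow a @ (eprod 2 i @ eprod (i + 2) n) @ gpow (n - i))"
      using ij by (intro rot_form_append rot_form_gpow rot_form_eprod) auto
    ultimately show ?thesis using rot_form_cong by blast
  next
    case False
    have ne: "pt (1 + int b) \<noteq> pt (1 - int i + int b)"
      using ij small_dvd[of "int i"] by (auto simp: pt_eq_iff)
    \<comment> \<open>The other way of matching image and domain would give that \<open>n\<close>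
      divides \<open>i + j\<close>, which lies strictly between \<open>0\<close> and
      \<open>n\<close>. Hence some image point lies outside the domain of
      \<open>x\<^sub>j\<close>.\<close>
    have "\<not> (pt (1 + int b) = 1 \<and> pt (1 - int i + int b) = j + 1)"
    proof
      assume "pt (1 + int b) = 1 \<and> pt (1 - int i + int b) = j + 1"
      hence d: "int n dvd int b" "int n dvd int b - int i - int j"
        using ij n4 by (auto simp: pt_eq_nat_iff algebra_simps)
      have "int n dvd int b - (int b - int i - int j)" using d by (rule dvd_diff)
      hence "int n dvd int i + int j" by simp
      thus False using small_dvd[of "int i + int j"] ij by simp
    qed
    thus ?thesis using out[of 1] out[of "1 - int i"] False ne by metis
  qed
qed

lemma normal_form: "w \<in> lists D \<Longrightarrow> rot_form w \<or> refl_form w"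
proof (induction w rule: rev_induct)
  case Nil
  thus ?case using rot_form_gpow[of 0] by simp
next
  case (snoc l w)
  hence IH: "rot_form w \<or> refl_form w" and l: "l \<in> D" by auto
  show ?case
  proof (cases l)
    case Lg
    have "refl_form (w @ [Lg])" if w: "refl_form w"
    proof -
      obtain a i b where i: "i \<in> {1..m}" and "w \<approx> gpow a @ [Lx i] @ gpow b"
        using w by (auto simp: refl_form_def)
      hence "w @ [Lg] \<approx> (gpow a @ [Lx i] @ gpow b) @ [Lg]" by (intro weq_right)
      also have "\<dots> = gpow a @ [Lx i] @ gpow (b + 1)" by (simp add: replicate_append_same)
      finally show ?thesis using i unfolding refl_form_def by blast
    qed
    thus ?thesis using IH Lg rot_form_append[OF _ rot_form_gpow[of 1]] by auto
  next
    case (Le j)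
    hence j: "j \<in> {1..n}" using l by simp
    thus ?thesis using Le IH rot_form_append[OF _ rot_form_Le[OF j]] refl_form_Le[OF j] by metis
  next
    case (Lx j)
    hence "j \<in> {1..m}" using l by simp
    thus ?thesis using Lx IH rot_form_Lx refl_form_Lx by metis
  qed
qed


section \<open>Evaluation of words\<close>

text \<open>On its two-point domain, \<open>Lx i\<close> is the reflection of t to 2 - t modulo
  \<open>n\<close>: it fixes \<open>1\<close> and sends \<open>i + 1\<close> to
  \<open>n - i + 1\<close>.\<close>

primrec lmap :: "letter \<Rightarrow> nat \<rightharpoonup> nat" where
  "lmap Lg = (\<lambda>p. if p \<in> {1..n} then Some (pt (int p + 1)) else None)"
| "lmap (Le j) = (\<lambda>p. if p \<in> {1..n} \<and> p \<noteq> j then Some p else None)"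
| "lmap (Lx i) = (\<lambda>p. if p \<in> {1..n} \<and> (p = 1 \<or> p = i + 1) then Some (pt (2 - int p)) else None)"

primrec wmap :: "letter list \<Rightarrow> nat \<rightharpoonup> nat" where
  "wmap [] = (\<lambda>p. if p \<in> {1..n} then Some p else None)"
| "wmap (l # w) = wmap w \<circ>\<^sub>m lmap l"

lemma lmap_Some: "lmap l p = Some q \<Longrightarrow> p \<in> {1..n} \<and> q \<in> {1..n}"
  by (cases l) (auto split: if_splits)

lemma wmap_Some: "wmap w p = Some q \<Longrightarrow> p \<in> {1..n} \<and> q \<in> {1..n}"
proof (induction w arbitrary: p)
  case (Cons l w)
  then obtain p' where "lmap l p = Some p'" "wmap w p' = Some q"
    by (auto simp: map_comp_Some_iff)
  thus ?case using Cons.IH lmap_Some by blast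
qed (auto split: if_splits)

lemma wmap_append: "wmap (u @ v) = wmap v \<circ>\<^sub>m wmap u"
proof (induction u)
  case Nil
  \<comment> \<open>The empty word is the identity on \<open>{1..n}\<close> only, so
    \<open>wmap v\<close> has to be undefined elsewhere.\<close>
  have "wmap v p = None" if "p \<notin> {1..n}" for p
    using wmap_Some[of v p] that by (cases "wmap v p") blast+
  thus ?case by (auto simp: fun_eq_iff map_comp_def)
qed (auto simp: fun_eq_iff map_comp_def split: option.split)

lemma wmap_single: "wmap [l] = lmap l"
proof
  fix p show "wmap [l] p = lmap l p"
    using lmap_Some[of l p] by (auto simp: map_comp_def split: option.split)
qed

lemma wmap_map_Le: "wmap (map Le as) p = (if p \<in> {1..n} \<and> p \<notin> set as then Some p else None)"
  by (induction as) (auto simp: map_comp_def)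

lemma wmap_eprod: "wmap (eprod a b) p = (if p \<in> {1..n} \<and> p \<notin> {a..b} then Some p else None)"
  unfolding eprod_def wmap_map_Le by auto

lemma wmap_gpow: "wmap (gpow k) p = (if p \<in> {1..n} then Some (pt (int p + int k)) else None)"
proof (induction k arbitrary: p)
  case (Suc k)
  show ?case
  proof (cases "p \<in> {1..n}")
    case True
    have "wmap (gpow (Suc k)) p = wmap (gpow k) (pt (int p + 1))" using True by (simp add: map_comp_def)
    also have "\<dots> = Some (pt (int p + 1 + int k))"
      unfolding Suc using pt_in by simp
    finally show ?thesis using True by (simp add: add_ac)
  qed (auto simp: map_comp_def)
qed auto

lemmas wmap_eval = wmap_append wmap_map_Le wmap_eprod wmap_gpow map_comp_def

lemma wmap_rot_form:
  "wmap (eword ts @ gpow k) p =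
     (if p \<in> {1..n} \<and> p \<notin> pt ` set ts then Some (pt (int p + int k)) else None)"
  by (simp add: wmap_eval eword_map_Le del: map_map)

lemma wmap_Lx_gpow: "wmap ([Lx i] @ gpow b) q =
    (if q \<in> {1..n} \<and> (q = 1 \<or> q = i + 1) then Some (pt (2 - int q + int b)) else None)"
  unfolding wmap_append wmap_single using pt_in by (simp add: map_comp_def wmap_gpow)

lemma wmap_refl_form:
  "wmap (gpow a @ [Lx i] @ gpow b) p =
     (if p \<in> {1..n} \<and> (pt (int p + int a) = 1 \<or> pt (int p + int a) = i + 1)
      then Some (pt (2 - int p - int a + int b)) else None)"
proof -
  have "pt (2 - int (pt t) + s) = pt (2 - t + s)" for t s
    using pt_minus_pt[of "2 + s" t] by (simp add: algebra_simps)
  hence "wmap ([Lx i] @ gpow b) (pt t) =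
      (if pt t = 1 \<or> pt t = i + 1 then Some (pt (2 - t + int b)) else None)" for t
    unfolding wmap_Lx_gpow using pt_in by simp
  thus ?thesis
    unfolding wmap_append[of "gpow a"] by (simp only: map_comp_def wmap_gpow) (simp add: algebra_simps)
qed

lemma pt_1 [simp]: "pt 1 = 1" "pt 1 = Suc 0"
  using pt_of_nat[of 1] n4 by auto

lemma pt_1_minus: "i \<in> {1..m} \<Longrightarrow> pt (1 - int i) = n - i + 1"
  using x_range[of i] by (subst pt_eq_nat_iff) auto

lemma pt_2_minus_Suc: "i \<in> {1..m} \<Longrightarrow> pt (2 - int (i + 1)) = n - i + 1"
  using pt_1_minus[of i] by simp

lemma wmap_Lx_Le: "wmap [Lx i, Le j] p =
    (if p \<in> {1..n} \<and> (p = 1 \<or> p = i + 1) \<and> pt (2 - int p) \<noteq> j then Some (pt (2 - int p)) else None)"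
  using pt_in by (simp add: map_comp_def)

lemma wmap_Le_Lx: "wmap [Le j, Lx i] p =
    (if p \<in> {1..n} \<and> p \<noteq> j \<and> (p = 1 \<or> p = i + 1) then Some (pt (2 - int p)) else None)"
  by (simp add: map_comp_def)

lemma wmap_relations: assumes "(u, v) \<in> relations n m" shows "wmap u = wmap v"
proof -
  have q1: "wmap (gpow n) = wmap []"
  proof
    fix p have "pt (int p + int n) = pt (int p)" by (simp add: pt_eq_iff)
    thus "wmap (gpow n) p = wmap [] p" unfolding wmap_gpow by simp
  qed
  have q2: "wmap [Le i, Le i] = wmap [Le i]" and q3: "wmap [Le i, Le j] = wmap [Le j, Le i]" for i j
    by (auto simp: map_comp_def)
  have Lg_Le: "wmap [Lg, Le j] p = (if p \<in> {1..n} \<and> pt (int p + 1) \<noteq> j then Some (pt (int p + 1)) else None)"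
    and Le_Lg: "wmap [Le j, Lg] p = (if p \<in> {1..n} \<and> p \<noteq> j then Some (pt (int p + 1)) else None)"
    for j p using pt_in by (auto simp: map_comp_def)
  have q4: "wmap [Lg, Le (pt (t + 1))] = wmap [Le (pt t), Lg]" for t
  proof
    fix p
    have "p = pt t \<longleftrightarrow> pt (int p + 1) = pt (t + 1)" if "p \<in> {1..n}"
      using pt_of_nat[OF that] pt_eq_iff by (metis add_diff_cancel_right)
    thus "wmap [Lg, Le (pt (t + 1))] p = wmap [Le (pt t), Lg] p" unfolding Lg_Le Le_Lg by auto
  qed
  have "pt (int n + 1) = 1" by (subst pt_eq_nat_iff) (use n4 in auto)
  hence q4a: "wmap [Lg, Le 1] = wmap [Le n, Lg]" using q4[of "int n"] n4 by simp
  have q4b: "wmap [Lg, Le (i + 1)] = wmap [Le i, Lg]" if "1 \<le> i" "i \<le> n - 1" for i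
  proof -
    have "pt (int i + 1) = i + 1" by (subst pt_eq_nat_iff) (use that n4 in auto)
    thus ?thesis using q4[of "int i"] that by simp
  qed
  have q5: "wmap ([Lg] @ eprod 1 n) = wmap (eprod 1 n)"
    by (rule ext) (simp add: wmap_eprod map_comp_def)
  have q6: "wmap [Le 1, Lx i] = wmap [Lx i, Le 1]"
    and q6': "wmap [Lx i, Le 1] = wmap (gpow (n - 2 * i) @ eprod 1 (n - i) @ eprod (n - i + 2) n)"
    and q7: "j \<noteq> 1 \<Longrightarrow> j \<noteq> n - i + 1 \<Longrightarrow> wmap [Lx i, Le j] = wmap [Lx i]"
    and q8: "j \<noteq> 1 \<Longrightarrow> j \<noteq> i + 1 \<Longrightarrow> wmap [Le j, Lx i] = wmap [Lx i]"
    and q9: "wmap [Lx i, Le (n - i + 1)] = wmap [Le (i + 1), Lx i]"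
    and q9': "wmap [Le (i + 1), Lx i] = wmap (eprod 2 n)"
    and q10: "wmap (([Lx i] @ gpow i) @ ([Lx i] @ gpow i)) = wmap (eprod 2 i @ eprod (i + 2) n)"
    if i: "i \<in> {1..m}" for i j
  proof -
    have ii: "1 \<le> i" "2 * i < n" using x_range[OF i] by auto
    note e = pt_2_minus_Suc[OF i] pt_1_minus[OF i]
    show "wmap [Le 1, Lx i] = wmap [Lx i, Le 1]"
      by (rule ext) (unfold wmap_Lx_Le wmap_Le_Lx, use ii e in auto)
    show "wmap [Lx i, Le j] = wmap [Lx i]" if "j \<noteq> 1" "j \<noteq> n - i + 1"
      by (rule ext) (unfold wmap_Lx_Le wmap_single, use ii e that in auto)
    show "wmap [Le j, Lx i] = wmap [Lx i]" if "j \<noteq> 1" "j \<noteq> i + 1"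
      by (rule ext) (unfold wmap_Le_Lx wmap_single, use that in auto)
    show "wmap [Lx i, Le (n - i + 1)] = wmap [Le (i + 1), Lx i]"
      by (rule ext) (unfold wmap_Lx_Le wmap_Le_Lx, use ii e in auto)
    show "wmap [Le (i + 1), Lx i] = wmap (eprod 2 n)"
      by (rule ext) (unfold wmap_Le_Lx wmap_eprod, use ii n4 in auto)
    show "wmap [Lx i, Le 1] = wmap (gpow (n - 2 * i) @ eprod 1 (n - i) @ eprod (n - i + 2) n)"
    proof
      fix p
      \<comment> \<open>Both sides of Q6 have rank one: the idempotents keep only
        \<open>n - i + 1\<close>, and rotation by \<open>n - 2 * i\<close> brings only
        \<open>i + 1\<close> there.\<close>
      have 1: "pt (int p + int (n - 2 * i)) = n - i + 1 \<longleftrightarrow> p = i + 1" if "p \<in> {1..n}"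
      proof -
        have "n - i + 1 \<in> {1..n}" using ii by auto
        hence "pt (int p + int (n - 2 * i)) = n - i + 1 \<longleftrightarrow> int n dvd int p - int (i + 1)"
          using ii by (subst pt_eq_nat_iff) (auto simp: of_nat_diff algebra_simps)
        also have "\<dots> \<longleftrightarrow> p = i + 1"
        proof
          assume "int n dvd int p - int (i + 1)"
          moreover have "\<bar>int p - int (i + 1)\<bar> < int n" using ii that by auto
          ultimately show "p = i + 1" using small_dvd by fastforce
        qed simp
        finally show ?thesis .
      qed
      have 2: "q \<notin> {1..n - i} \<and> q \<notin> {n - i + 2..n} \<longleftrightarrow> q = n - i + 1" if "q \<in> {1..n}" for q
        using that ii by auto
      have "wmap (gpow (n - 2 * i) @ eprod 1 (n - i) @ eprod (n - i + 2) n) p =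
            (if p \<in> {1..n} \<and> pt (int p + int (n - 2 * i)) = n - i + 1 then Some (n - i + 1) else None)"
      proof -
        define q where "q = pt (int p + int (n - 2 * i))"
        have q: "q \<in> {1..n}" unfolding q_def by (rule pt_in)
        have "wmap (gpow (n - 2 * i)) p = (if p \<in> {1..n} then Some q else None)"
          by (simp only: wmap_gpow q_def)
        hence "wmap (gpow (n - 2 * i) @ eprod 1 (n - i) @ eprod (n - i + 2) n) p =
            (if p \<in> {1..n} \<and> (q \<notin> {1..n - i} \<and> q \<notin> {n - i + 2..n}) then Some q else None)"
          using q by (simp add: wmap_append wmap_eprod map_comp_def)
        thus ?thesis unfolding 2[OF q] q_def[symmetric] by simp
      qed
      also have "\<dots> = wmap [Lx i, Le 1] p"
        unfolding wmap_Lx_Le using 1 e ii by auto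
      finally show "wmap [Lx i, Le 1] p = 
        wmap (gpow (n - 2 * i) @ eprod 1 (n - i) @ eprod (n - i + 2) n) p" ..
    qed
    show "wmap (([Lx i] @ gpow i) @ ([Lx i] @ gpow i)) = wmap (eprod 2 i @ eprod (i + 2) n)"
    proof
      fix p
      \<comment> \<open>The word \<open>x\<^sub>i g\<^sup>i\<close> swaps \<open>1\<close> and
        \<open>i + 1\<close>, so its square is the identity on these two points, as Q10
        says.\<close>
      have 1: "wmap ([Lx i] @ gpow i) q =
        (if q = 1 then Some (i + 1) else if q = i + 1 then Some 1 else None)" for q
      proof -
        have "pt (1 + int i) = i + 1" by (subst pt_eq_nat_iff) (use ii in auto)
        thus ?thesis unfolding wmap_Lx_gpow using ii by auto
      qed
      show "wmap (([Lx i] @ gpow i) @ ([Lx i] @ gpow i)) p = wmap (eprod 2 i @ eprod (i + 2) n) p"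
        unfolding wmap_append[of "[Lx i] @ gpow i"] wmap_append[of "eprod 2 i"] map_comp_def 1
        using ii by (auto simp: wmap_eprod)
    qed
  qed
  note [simp del] = wmap.simps
  show ?thesis
    using assms unfolding relations_def
    by (elim UnE) (auto intro: q1 q2 q3 q7 q8 q4a[simplified] q4b[simplified] q5[simplified]
        q6[simplified] q6'[simplified] q9[simplified] q9'[simplified] q10[simplified])
qed


section \<open>Evaluation as a complete invariant of words\<close>

lemma wmap_weq: assumes "u \<approx> v" "u \<in> lists D" shows "wmap u = wmap v"
proof -
  have "(u, v) \<in> R" using assms weq_iff by blast
  thus ?thesis
    using generated_congruence_subset_kernel[OF relations_lists, of wmap "sym_inv_monoid n"]
      wmap_append wmap_relations
    by (auto simp: sym_inv_monoid_def)
qed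

text \<open>The domain determines the set of killed points, and any surviving point determines the
  exponent modulo \<open>n\<close>. If no point survives, Q5 removes all powers of
  \<open>g\<close>.\<close>

lemma rot_form_inject:
  assumes eq: "wmap (eword ts @ gpow k) = wmap (eword ss @ gpow l)"
  shows "eword ts @ gpow k \<approx> eword ss @ gpow l"
proof -
  have val: "(if p \<in> {1..n} \<and> p \<notin> pt ` set ts then Some (pt (int p + int k)) else None) =
       (if p \<in> {1..n} \<and> p \<notin> pt ` set ss then Some (pt (int p + int l)) else None)" for p
    using fun_cong[OF eq, of p] unfolding wmap_rot_form .
  have in_range: "pt ` set xs \<subseteq> {1..n}" for xs using pt_in by auto
  have "p \<in> pt ` set ts \<longleftrightarrow> p \<in> pt ` set ss" if "p \<in> {1..n}" for p
    using val[of p] that by (auto split: if_splits)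
  hence sets: "pt ` set ts = pt ` set ss" using in_range by blast
  have e: "eword ts \<approx> eword ss"
    unfolding eword_map_Le using sets in_range by (intro map_Le_cong) auto
  show ?thesis
  proof (cases "pt ` set ss = {1..n}")
    case True
    have E: "eword xs \<approx> eprod 1 n" if "pt ` set xs = {1..n}" for xs
      unfolding eword_map_Le eprod_def using that by (intro map_Le_cong) auto
    have *: "eword xs @ gpow j \<approx> eprod 1 n" if "pt ` set xs = {1..n}" for xs j
    proof (induction j)
      case 0
      show ?case using E[OF that] by simp
    next
      case (Suc j)
      \<comment> \<open>The shifted indices that appear when \<open>g\<close> moves to the front.
        They again represent all points, so the idempotents can be replaced by
        \<open>eprod 1 n\<close>, which absorbs \<open>g\<close> from the left.\<close>
      define ys where "ys = map (\<lambda>t. t + 1) xs"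
      have "pt ` set ys = {1..n}"
      proof -
        have "p \<in> pt ` set ys" if p: "p \<in> {1..n}" for p
        proof -
          obtain t where t: "t \<in> set xs" "pt (int p - 1) = pt t"
            using pt_in \<open>pt ` set xs = {1..n}\<close> by (metis imageE)
          hence "p = pt (t + 1)" using p by (metis pt_of_nat pt_pt_add diff_add_cancel)
          thus ?thesis using t by (auto simp: ys_def)
        qed
        thus ?thesis using in_range[of ys] by blast
      qed
      have "eword xs @ gpow (Suc j) = (eword xs @ gpow j) @ [Lg]"
        by (simp add: replicate_append_same)
      also have "\<dots> \<approx> eprod 1 n @ [Lg]" by (intro weq_right Suc)
      also have "\<dots> \<approx> eword xs @ [Lg]" by (intro weq_right weq_sym[OF E] that)
      also have "\<dots> \<approx> [Lg] @ eword ys"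
        using weq_sym[OF gpow_eword[of 1 ys]] by (simp add: ys_def comp_def)
      also have "\<dots> \<approx> [Lg] @ eprod 1 n" by (intro weq_left E) fact
      also have "\<dots> \<approx> eprod 1 n" by (rule Lg_eprod)
      finally show ?case .
    qed
    show ?thesis using *[of ts k] *[of ss l] True sets weq_sym weq_trans by metis
  next
    case False
    then obtain p where p: "p \<in> {1..n}" "p \<notin> pt ` set ss" using in_range by blast
    hence "pt (int p + int k) = pt (int p + int l)" using val[of p] sets by simp
    hence "int n dvd int k - int l" by (simp add: pt_eq_iff)
    thus ?thesis by (intro weq_append e gpow_cong)
  qed
qed

lemma wmap_refl_form_pt:
  "wmap (gpow a @ [Lx i] @ gpow b) (pt t) =
     (if pt (t + int a) = 1 \<or> pt (t + int a) = i + 1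
      then Some (pt (2 - t - int a + int b)) else None)"
proof -
  have "pt (2 - int (pt t) - int a + int b) = pt (2 - t - int a + int b)"
    using pt_minus_pt[of "2 - int a + int b" t] by (simp add: algebra_simps)
  thus ?thesis unfolding wmap_refl_form pt_pt_add using pt_in by simp
qed

lemma wmap_refl_form_points:
  "wmap (gpow a @ [Lx i] @ gpow b) (pt (1 - int a)) = Some (pt (1 + int b))"
  "i \<in> {1..m} \<Longrightarrow> wmap (gpow a @ [Lx i] @ gpow b) (pt (1 + int i - int a)) = Some (pt (1 - int i + int b))"
proof -
  show "wmap (gpow a @ [Lx i] @ gpow b) (pt (1 - int a)) = Some (pt (1 + int b))"
    unfolding wmap_refl_form_pt by simp
  assume i: "i \<in> {1..m}"
  have "pt (1 + int i) = i + 1" using x_range[OF i] by (subst pt_eq_nat_iff) auto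
  thus "wmap (gpow a @ [Lx i] @ gpow b) (pt (1 + int i - int a)) = Some (pt (1 - int i + int b))"
    unfolding wmap_refl_form_pt by simp
qed

text \<open>A rotation displaces all points equally, whereas the two points of the reflection have
  displacements differing by \<open>2 * i\<close>, and \<open>0 < 2 * i < n\<close>.\<close>

lemma refl_form_neq_rot_form:
  assumes i: "i \<in> {1..m}"
  shows "wmap (gpow a @ [Lx i] @ gpow b) \<noteq> wmap (eword ts @ gpow k)"
proof
  assume eq: "wmap (gpow a @ [Lx i] @ gpow b) = wmap (eword ts @ gpow k)"
  have "pt (1 + int b) = pt (1 - int a + int k)"
    using wmap_refl_form_points(1)[of a i b] unfolding eq wmap_rot_form by (simp split: if_splits)
  moreover have "pt (1 - int i + int b) = pt (1 + int i - int a + int k)"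
    using wmap_refl_form_points(2)[OF i, of a b] unfolding eq wmap_rot_form by (simp split: if_splits)
  ultimately have "int n dvd (1 + int b) - (1 - int a + int k)"
    "int n dvd (1 - int i + int b) - (1 + int i - int a + int k)"
    unfolding pt_eq_iff by auto
  from dvd_diff[OF this] have "int n dvd 2 * int i" by (simp add: algebra_simps)
  thus False using small_dvd[of "2 * int i"] x_range[OF i] by simp
qed

text \<open>The domains are two-point sets at cyclic distances \<open>i\<close> and
  \<open>j\<close>. Since both are below \<open>n / 2\<close>, equal domains match first point with
  first point; this gives \<open>a\<close> and \<open>c\<close> congruent modulo \<open>n\<close>,
  then \<open>i = j\<close>, and the images give \<open>b\<close> and \<open>d\<close>
  congruent.\<close>

lemma refl_form_inject:
  assumes i: "i \<in> {1..m}" and j: "j \<in> {1..m}"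
    and eq: "wmap (gpow a @ [Lx i] @ gpow b) = wmap (gpow c @ [Lx j] @ gpow d)"
  shows "gpow a @ [Lx i] @ gpow b \<approx> gpow c @ [Lx j] @ gpow d"
proof -
  have ij: "1 \<le> i" "2 * i < n" "1 \<le> j" "2 * j < n" using x_range i j by auto
  have one: "pt t = Suc 0 \<longleftrightarrow> int n dvd t - 1" for t using n4 by (subst pt_eq_nat_iff) auto
  have sj: "pt t = Suc j \<longleftrightarrow> int n dvd t - int j - 1" for t
    using ij by (subst pt_eq_nat_iff) (auto simp: algebra_simps)
  have 1: "int n dvd int c - int a \<or> int n dvd int c - int a - int j"
    and 2: "pt (1 + int b) = pt (1 + int a - int c + int d)"
    using wmap_refl_form_points(1)[of a i b] unfolding eq wmap_refl_form_pt
    by (auto simp: one sj algebra_simps split: if_splits)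
  have 3: "int n dvd int i + int c - int a \<or> int n dvd int i + int c - int a - int j"
    using wmap_refl_form_points(2)[OF i, of a b] unfolding eq wmap_refl_form_pt
    by (auto simp: one sj algebra_simps split: if_splits)
  have no: "\<not> int n dvd int i" "\<not> int n dvd int i + int j"
    using small_dvd[of "int i"] small_dvd[of "int i + int j"] ij by auto
  \<comment> \<open>If the first points did not match, they would be crossed over, and
    \<open>n\<close> would divide \<open>i + j\<close> or \<open>i\<close>.\<close>
  have ca: "int n dvd int c - int a"
  proof (rule ccontr)
    assume "\<not> ?thesis"
    hence 4: "int n dvd int c - int a - int j" using 1 by simp
    from 3 show False
    proof
      assume "int n dvd int i + int c - int a"
      from dvd_diff[OF this 4] show False using no by (simp add: algebra_simps)
    next
      assume "int n dvd int i + int c - int a - int j"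
      from dvd_diff[OF this 4] show False using no by (simp add: algebra_simps)
    qed
  qed
  have "int n dvd int i - int j"
    using 3
  proof
    assume "int n dvd int i + int c - int a"
    from dvd_diff[OF this ca] show ?thesis using no by (simp add: algebra_simps)
  next
    assume "int n dvd int i + int c - int a - int j"
    from dvd_diff[OF this ca] show ?thesis by (simp add: algebra_simps)
  qed
  hence ij_eq: "i = j" using small_dvd[of "int i - int j"] ij by simp
  have "int n dvd (1 + int b) - (1 + int a - int c + int d)" using 2 by (simp only: pt_eq_iff)
  from dvd_diff[OF this ca] have "int n dvd int b - int d" by (simp add: algebra_simps)
  moreover have "int n dvd int a - int c" using ca by (simp add: dvd_diff_commute)
  ultimately show ?thesis unfolding ij_eq by (intro weq_append gpow_cong weq_refl)
qed

text \<open>Both words are replaced by normal forms with the same evaluations; the two kinds never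
  evaluate alike, so an injectivity lemma for one kind applies.\<close>

lemma wmap_inject:
  assumes u: "u \<in> lists D" and v: "v \<in> lists D" and eq: "wmap u = wmap v"
  shows "u \<approx> v"
proof -
  have main: "\<exists>w. w \<approx> u \<and> wmap w = wmap u \<and>
      ((\<exists>ts k. w = eword ts @ gpow k) \<or> (\<exists>a i b. i \<in> {1..m} \<and> w = gpow a @ [Lx i] @ gpow b))"
    if "u \<in> lists D" for u
    using normal_form[OF that] wmap_weq[OF _ that] weq_sym
    unfolding rot_form_def refl_form_def by metis
  obtain u' v' where u': "u' \<approx> u" "wmap u' = wmap u"
      "(\<exists>ts k. u' = eword ts @ gpow k) \<or> (\<exists>a i b. i \<in> {1..m} \<and> u' = gpow a @ [Lx i] @ gpow b)"
    and v': "v' \<approx> v" "wmap v' = wmap v"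
      "(\<exists>ts k. v' = eword ts @ gpow k) \<or> (\<exists>a i b. i \<in> {1..m} \<and> v' = gpow a @ [Lx i] @ gpow b)"
    using main[OF u] main[OF v] by blast
  have eq': "wmap u' = wmap v'" using eq u' v' by simp
  have "u' \<approx> v'"
    using u'(3) v'(3) eq' refl_form_neq_rot_form rot_form_inject refl_form_inject by metis
  thus ?thesis using u'(1) v'(1) weq_sym weq_trans by blast
qed


section \<open>Rotations and reflections\<close>

lemma rot_pt: "rot n (pt t) = pt (t + 1)"
proof -
  have "pt (int n + 1) = 1" by (subst pt_eq_nat_iff) (use n4 in auto)
  moreover have "pt (int j + 1) = j + 1" if "j \<in> {1..n}" "j \<noteq> n" for j
    by (subst pt_eq_nat_iff) (use that in auto)
  ultimately have "rot n j = pt (int j + 1)" if "j \<in> {1..n}" for j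
    using that by (auto simp: rot_def)
  thus ?thesis using pt_in by (metis pt_pt_add)
qed

lemma flip_pt: "flip n (pt t) = pt (1 - t)"
proof -
  have "flip n j = pt (1 - int j)" if "j \<in> {1..n}" for j
  proof -
    have "pt (1 - int j) = n + 1 - j" by (subst pt_eq_nat_iff) (use that in auto)
    thus ?thesis using that by (simp add: flip_def)
  qed
  thus ?thesis using pt_in by (metis pt_minus_pt)
qed

lemma pt_surj: "p \<in> {1..n} \<Longrightarrow> \<exists>t. p = pt t"
  using pt_of_nat by metis

text \<open>The right inverse \<open>u'\<close> of \<open>u\<close> makes \<open>f\<close>
  surjective on the finite set \<open>{1..n}\<close>, hence bijective there.\<close>

lemma permutes_ptI:
  assumes "\<And>p. p \<notin> {1..n} \<Longrightarrow> f p = p" and "\<And>t. f (pt t) = pt (u t)"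
    and "\<And>t. u (u' t) = t"
  shows "f permutes {1..n}"
proof (rule bij_imp_permutes)
  have sub: "f ` {1..n} \<subseteq> {1..n}" using assms(2) pt_surj pt_in by fastforce
  have sup: "p \<in> f ` {1..n}" if p: "p \<in> {1..n}" for p
  proof -
    obtain t where "p = pt t" using pt_surj[OF p] ..
    hence "p = f (pt (u' t))" using assms by simp
    thus ?thesis using pt_in by blast
  qed
  hence im: "f ` {1..n} = {1..n}" using sub by blast
  moreover have "inj_on f {1..n}" using im by (intro eq_card_imp_inj_on) auto
  ultimately show "bij_betw f {1..n} {1..n}" by (simp add: bij_betw_def)
qed (use assms in auto)

lemma rot_permutes: "rot n permutes {1..n}"
  by (rule permutes_ptI[where u = "\<lambda>t. t + 1" and u' = "\<lambda>t. t - 1"]) (simp_all only: rot_pt, auto simp: rot_def)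

lemma flip_permutes: "flip n permutes {1..n}"
  by (rule permutes_ptI[where u = "\<lambda>t. 1 - t" and u' = "\<lambda>t. 1 - t"]) (simp_all only: flip_pt, auto simp: flip_def)

section \<open>Dihedral elements as maps modulo n\<close>

definition is_rot :: "(nat \<Rightarrow> nat) \<Rightarrow> bool" where
  "is_rot p \<longleftrightarrow> (\<exists>k. \<forall>t. p (pt t) = pt (t + k))"

definition is_refl :: "(nat \<Rightarrow> nat) \<Rightarrow> bool" where
  "is_refl p \<longleftrightarrow> (\<exists>s. \<forall>t. p (pt t) = pt (s - t))"

lemma dihedral_cases: "p \<in> dihedral n \<Longrightarrow> is_rot p \<or> is_refl p"
  unfolding dihedral_def
proof (induction rule: generate.induct)
  case one
  have "is_rot id" unfolding is_rot_def by (rule exI[of _ 0]) simp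
  thus ?case unfolding sym_group_one ..
next
  case (incl h)
  moreover have "is_rot (rot n)" unfolding is_rot_def using rot_pt by blast
  moreover have "is_refl (flip n)" unfolding is_refl_def using flip_pt by blast
  ultimately show ?case by auto
next
  case (inv h)
  \<comment> \<open>Inverses enter \<open>generate\<close> only for the two generators; each is
    computed by applying it to a known image.\<close>
  have inv: "(inv\<^bsub>sym_group n\<^esub> h) (h x) = x" if "h permutes {1..n}" for x
  proof -
    have "inv\<^bsub>sym_group n\<^esub> h \<otimes>\<^bsub>sym_group n\<^esub> h = \<one>\<^bsub>sym_group n\<^esub>"
      using that by (intro group.l_inv sym_group_is_group) (simp add: sym_group_carrier)
    thus ?thesis by (simp add: sym_group_mult sym_group_one fun_eq_iff)
  qed
  from inv.hyps show ?case
  proof (elim insertE emptyE)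
    assume h: "h = rot n"
    have "(inv\<^bsub>sym_group n\<^esub> h) (pt t) = pt (t + (-1))" for t
      using inv[of "pt (t - 1)"] rot_permutes rot_pt[of "t - 1"] h by simp
    thus ?thesis unfolding is_rot_def by blast
  next
    assume h: "h = flip n"
    have "(inv\<^bsub>sym_group n\<^esub> h) (pt t) = pt (1 - t)" for t
      using inv[of "pt (1 - t)"] flip_permutes flip_pt[of "1 - t"] h by simp
    thus ?thesis unfolding is_refl_def by blast
  qed
next
  case (eng p q)
  have "is_rot (p \<circ> q)" if pq: "is_rot p" "is_rot q"
  proof -
    obtain k l where "\<forall>t. p (pt t) = pt (t + k)" "\<forall>t. q (pt t) = pt (t + l)"
      using pq unfolding is_rot_def by blast
    hence "(p \<circ> q) (pt t) = pt (t + (l + k))" for t by (simp add: add_ac)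
    thus ?thesis unfolding is_rot_def by blast
  qed
  moreover have "is_refl (p \<circ> q)" if pq: "is_rot p" "is_refl q"
  proof -
    obtain k l where "\<forall>t. p (pt t) = pt (t + k)" "\<forall>t. q (pt t) = pt (l - t)"
      using pq unfolding is_rot_def is_refl_def by blast
    hence "(p \<circ> q) (pt t) = pt ((l + k) - t)" for t by (simp add: algebra_simps)
    thus ?thesis unfolding is_refl_def by blast
  qed
  moreover have "is_refl (p \<circ> q)" if pq: "is_refl p" "is_rot q"
  proof -
    obtain k l where "\<forall>t. p (pt t) = pt (k - t)" "\<forall>t. q (pt t) = pt (t + l)"
      using pq unfolding is_rot_def is_refl_def by blast
    hence "(p \<circ> q) (pt t) = pt ((k - l) - t)" for t by (simp add: algebra_simps)
    thus ?thesis unfolding is_refl_def by blast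
  qed
  moreover have "is_rot (p \<circ> q)" if pq: "is_refl p" "is_refl q"
  proof -
    obtain k l where "\<forall>t. p (pt t) = pt (k - t)" "\<forall>t. q (pt t) = pt (l - t)"
      using pq unfolding is_refl_def by blast
    hence "(p \<circ> q) (pt t) = pt (t + (k - l))" for t by (simp add: algebra_simps)
    thus ?thesis unfolding is_rot_def by blast
  qed
  ultimately show ?case unfolding sym_group_mult using eng.IH by blast
qed

lemma rot_pow_dihedral: "rot n ^^ k \<in> dihedral n"
proof (induction k)
  case 0
  show ?case using generate.one[of "sym_group n"] by (simp add: dihedral_def sym_group_one id_def)
next
  case (Suc k)
  have "rot n \<otimes>\<^bsub>sym_group n\<^esub> (rot n ^^ k) \<in> dihedral n"
    using Suc unfolding dihedral_def by (auto intro: generate.eng[OF generate.incl])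
  thus ?case by (simp add: sym_group_mult comp_def)
qed

lemma rot_pow_pt: "(rot n ^^ k) (pt t) = pt (t + int k)"
  by (induction k) (simp_all add: rot_pt add_ac)

lemma refl_dihedral: "\<exists>p\<in>dihedral n. \<forall>t. p (pt t) = pt (s - t)"
proof -
  \<comment> \<open>\<open>flip n\<close> is the reflection of t to 1 - t, so rotating afterwards by
    \<open>s - 1\<close> gives s - t.\<close>
  define k where "k = nat ((s - 1) mod int n)"
  have "(rot n ^^ k) \<otimes>\<^bsub>sym_group n\<^esub> flip n \<in> dihedral n"
    using rot_pow_dihedral[of k] unfolding dihedral_def
    by (auto intro: generate.eng[OF _ generate.incl])
  hence "(rot n ^^ k) \<circ> flip n \<in> dihedral n" by (simp add: sym_group_mult)
  moreover have "((rot n ^^ k) \<circ> flip n) (pt t) = pt (s - t)" for t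
  proof -
    have "int k = (s - 1) mod int n" using n4 by (simp add: k_def)
    moreover have "int n dvd (s - 1) - (s - 1) mod int n" by simp
    ultimately have "int n dvd - ((1 - t + int k) - (s - t))" by (simp add: algebra_simps)
    hence "int n dvd (1 - t + int k) - (s - t)" by (simp only: dvd_minus_iff)
    thus ?thesis by (simp add: flip_pt rot_pow_pt pt_eq_iff)
  qed
  ultimately show ?thesis by blast
qed

section \<open>Orientation\<close>

lemma pt_add_nat: "p \<in> {1..n} \<Longrightarrow> k < n \<Longrightarrow> pt (int p + int k) = (if p + k \<le> n then p + k else p + k - n)"
  by (subst pt_eq_nat_iff) (auto simp: of_nat_diff)

lemma pt_diff_nat: "p \<in> {1..n} \<Longrightarrow> s \<in> {1..n} \<Longrightarrow>
    pt (int s - int p) = (if p < s then s - p else s + n - p)"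
  by (subst pt_eq_nat_iff) (auto simp: of_nat_diff)

lemma cyclic_seq_iff:
  "cyclic_seq xs \<longleftrightarrow> (\<forall>i<length xs. \<forall>j<length xs. i < j \<longrightarrow>
      \<not> (xs ! i > xs ! (Suc i mod length xs) \<and> xs ! j > xs ! (Suc j mod length xs)))"
proof -
  define P where "P i \<longleftrightarrow> xs ! i > xs ! (Suc i mod length xs)" for i
  have "cyclic_seq xs \<longleftrightarrow> (\<forall>i\<in>{i. i < length xs \<and> P i}. \<forall>j\<in>{i. i < length xs \<and> P i}. i = j)"
    unfolding cyclic_seq_def One_nat_def P_def by (rule card_le_Suc0_iff_eq) simp
  also have "\<dots> \<longleftrightarrow> (\<forall>i<length xs. \<forall>j<length xs. i < j \<longrightarrow> \<not> (P i \<and> P j))"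
    by (auto intro: linorder_neqE_nat)
  finally show ?thesis unfolding P_def .
qed

text \<open>A descent before the last position occurs only where adding \<open>k\<close> passes
  \<open>n\<close>. All later values have then wrapped as well, so they increase and stay below the
  value at the first entry, which rules out a second descent.\<close>

lemma cyclic_seq_rot:
  assumes L: "sorted_wrt (<) L" "set L \<subseteq> {1..n}" and k: "k < n"
  shows "cyclic_seq (map (\<lambda>p. pt (int p + int k)) L)"
  unfolding cyclic_seq_iff
proof (intro allI impI notI, elim conjE)
  let ?f = "\<lambda>p. pt (int p + int k)"
  let ?xs = "map ?f L"
  fix i j
  assume ij: "i < length ?xs" "j < length ?xs" "i < j"
    and di: "?xs ! (Suc i mod length ?xs) < ?xs ! i" and dj: "?xs ! (Suc j mod length ?xs) < ?xs ! j"
  have f: "?f (L ! a) = (if L ! a + k \<le> n then L ! a + k else L ! a + k - n)" "1 \<le> L ! a" "L ! a \<le> n"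
    if "a < length L" for a
  proof -
    have "L ! a \<in> {1..n}" using that L(2) nth_mem by blast
    thus "?f (L ! a) = (if L ! a + k \<le> n then L ! a + k else L ! a + k - n)" "1 \<le> L ! a" "L ! a \<le> n"
      using pt_add_nat k by auto
  qed
  have mono: "L ! a < L ! b" if "a < b" "b < length L" for a b
    using L(1) that by (simp add: sorted_wrt_iff_nth_less)
  have si: "Suc i < length L" using ij by simp
  have wrap_i: "L ! i + k \<le> n" "n < L ! Suc i + k"
    using di si f[of i] f[of "Suc i"] mono[of i "Suc i"] by (auto split: if_splits)
  have le: "L ! Suc i \<le> L ! j" using mono[of "Suc i" j] ij by (cases "Suc i = j") auto
  show False
  proof (cases "Suc j < length L")
    case True
    thus False using dj le wrap_i f[of j] f[of "Suc j"] mono[of j "Suc j"] by (auto split: if_splits)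
  next
    \<comment> \<open>The closing step from the last entry to the first: the last value has been
      lowered by \<open>n\<close> and the first has not, so no descent is possible.\<close>
    case False
    hence sj: "Suc j = length L" using ij by simp
    have "0 < length L" using ij by (cases L) auto
    have le0: "L ! 0 \<le> L ! i" using mono[of 0 i] ij by (cases "i = 0") auto
    have "?f (L ! 0) < ?f (L ! j)" using dj sj ij \<open>0 < length L\<close> by simp
    thus False using f[of j] f[of 0] le0 le wrap_i k sj \<open>0 < length L\<close> by (auto split: if_splits)
  qed
qed

text \<open>A reflected increasing sequence falls except where it jumps up by \<open>n\<close> on
  reaching \<open>s\<close>. Going round the circle there is just one such place, so at least two of
  the steps from entry 0 to 1, from 1 to 2 and from the last to 0 are descents.\<close>

lemma not_cyclic_seq_refl:
  assumes L: "sorted_wrt (<) L" "set L \<subseteq> {1..n}" and s: "s \<in> {1..n}" and len: "3 \<le> length L"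
  shows "\<not> cyclic_seq (map (\<lambda>p. pt (int s - int p)) L)"
proof
  let ?f = "\<lambda>p. pt (int s - int p)"
  let ?xs = "map ?f L"
  let ?l = "length L - 1"
  assume c: "cyclic_seq ?xs"
  have f: "?f (L ! a) = (if L ! a < s then s - L ! a else s + n - L ! a)" "1 \<le> L ! a" "L ! a \<le> n"
    if "a < length L" for a
  proof -
    have "L ! a \<in> {1..n}" using that L(2) nth_mem by blast
    thus "?f (L ! a) = (if L ! a < s then s - L ! a else s + n - L ! a)" "1 \<le> L ! a" "L ! a \<le> n"
      using pt_diff_nat s by auto
  qed
  have mono: "L ! a < L ! b" if "a < b" "b < length L" for a b
    using L(1) that by (simp add: sorted_wrt_iff_nth_less)
  have 012: "L ! 0 < L ! 1" "L ! 1 < L ! 2" using mono len by auto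
  have "2 = ?l \<or> 2 < ?l \<and> ?l < length L" using len by linarith
  hence 2: "L ! 2 \<le> L ! ?l" using mono[of 2 ?l] by (auto simp del: One_nat_def)
  have len': "0 < length L" "1 < length L" "2 < length L" "?l < length L" "Suc ?l = length L"
    using len by auto
  have "\<not> (?f (L ! 0) > ?f (L ! 1) \<and> ?f (L ! 1) > ?f (L ! 2))"
    using c[unfolded cyclic_seq_iff, rule_format, of 0 1] len' by (simp add: numeral_2_eq_2)
  moreover have "\<not> (?f (L ! 0) > ?f (L ! 1) \<and> ?f (L ! ?l) > ?f (L ! 0))"
    using c[unfolded cyclic_seq_iff, rule_format, of 0 ?l] len' len by simp
  moreover have "\<not> (?f (L ! 1) > ?f (L ! 2) \<and> ?f (L ! ?l) > ?f (L ! 0))"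
    using c[unfolded cyclic_seq_iff, rule_format, of 1 ?l] len' len by (simp add: numeral_2_eq_2)
  ultimately show False
    unfolding f(1)[OF len'(1)] f(1)[OF len'(2)] f(1)[OF len'(3)] f(1)[OF len'(4)]
    using f(2,3)[OF len'(1)] f(2,3)[OF len'(4)] 012 2 s
    by (simp split: if_splits) linarith+
qed

lemma cyclic_seq_short: "length xs \<le> 2 \<Longrightarrow> cyclic_seq xs"
  unfolding cyclic_seq_iff
proof (intro allI impI notI, elim conjE)
  fix i j assume *: "length xs \<le> 2" "i < length xs" "j < length xs" "i < j"
    "xs ! (Suc i mod length xs) < xs ! i" "xs ! (Suc j mod length xs) < xs ! j"
  have i: "i = 0" and j: "j = 1" and l: "length xs = 2" using *(1-4) by linarith+
  show False using *(5,6) unfolding i j l by simp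
qed


section \<open>The image\<close>

lemma orientation_preserving_restrict:
  assumes "A \<subseteq> {1..n}"
  shows "orientation_preserving ((Some \<circ> p) |` A) = cyclic_seq (map p (sorted_list_of_set A))"
proof -
  have fin: "finite A" using assms finite_subset by blast
  have d: "dom ((Some \<circ> p) |` A) = A" by (auto simp: dom_def restrict_map_def)
  have e: "map (\<lambda>a. the (((Some \<circ> p) |` A) a)) (sorted_list_of_set A) =
      map p (sorted_list_of_set A)"
    using fin by (intro map_cong) (auto simp: restrict_map_def)
  show ?thesis unfolding orientation_preserving_def d e ..
qed

lemma OPDI_carrier:
  "carrier (OPDI n) = {(Some \<circ> p) |` A | p A. p \<in> dihedral n \<and> A \<subseteq> {1..n} \<and>
     cyclic_seq (map p (sorted_list_of_set A))}"
proof -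
  have "carrier (OPDI n) = {\<alpha> \<in> {(Some \<circ> p) |` A | p A. p \<in> dihedral n \<and> A \<subseteq> {1..n}}.
      orientation_preserving \<alpha>}"
    by (simp add: OPDI_def DI_def)
  also have "\<dots> = {(Some \<circ> p) |` A | p A. p \<in> dihedral n \<and> A \<subseteq> {1..n} \<and>
      orientation_preserving ((Some \<circ> p) |` A)}" by blast
  also have "\<dots> = {(Some \<circ> p) |` A | p A. p \<in> dihedral n \<and> A \<subseteq> {1..n} \<and>
      cyclic_seq (map p (sorted_list_of_set A))}"
    by (simp only: orientation_preserving_restrict cong: conj_cong)
  finally show ?thesis .
qed

lemma sorted_list_of_subset:
  assumes "A \<subseteq> {1..n}"
  shows "sorted_wrt (<) (sorted_list_of_set A)" "set (sorted_list_of_set A) \<subseteq> {1..n}"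
    "length (sorted_list_of_set A) = card A"
proof -
  have "finite A" using assms finite_subset by blast
  thus "sorted_wrt (<) (sorted_list_of_set A)" "set (sorted_list_of_set A) \<subseteq> {1..n}"
    "length (sorted_list_of_set A) = card A" using assms by auto
qed

lemma restrict_in_OPDI_rot:
  assumes A: "A \<subseteq> {1..n}"
  shows "(\<lambda>p. if p \<in> A then Some (pt (int p + int k)) else None) \<in> carrier (OPDI n)"
proof -
  \<comment> \<open>The exponent is reduced because \<open>cyclic_seq_rot\<close> requires a shift
    below \<open>n\<close>.\<close>
  let ?p = "rot n ^^ (k mod n)"
  have eq: "?p q = pt (int q + int (k mod n))" if "q \<in> {1..n}" for q
    using rot_pow_pt[of "k mod n" "int q"] that by simp
  have eq': "?p q = pt (int q + int k)" if "q \<in> {1..n}" for q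
  proof -
    have "int n dvd int (k mod n) - int k"
      using dvd_minus_mod[of "int n" "int k"] by (simp add: zmod_int dvd_diff_commute)
    thus ?thesis unfolding eq[OF that] by (simp add: pt_eq_iff)
  qed
  note L = sorted_list_of_subset[OF A]
  have m: "map ?p (sorted_list_of_set A) = map (\<lambda>q. pt (int q + int (k mod n))) (sorted_list_of_set A)"
    using L(2) eq by (intro map_cong refl) blast
  have "cyclic_seq (map ?p (sorted_list_of_set A))"
    unfolding m by (rule cyclic_seq_rot[OF L(1,2)]) (use n4 in simp)
  moreover have "(\<lambda>p. if p \<in> A then Some (pt (int p + int k)) else None) = (Some \<circ> ?p) |` A"
    using A eq' by (auto simp: fun_eq_iff restrict_map_def)
  ultimately show ?thesis unfolding OPDI_carrier using A rot_pow_dihedral by blast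
qed

lemma restrict_in_OPDI_refl:
  assumes A: "A \<subseteq> {1..n}" "card A \<le> 2"
  shows "(\<lambda>p. if p \<in> A then Some (pt (s - int p)) else None) \<in> carrier (OPDI n)"
proof -
  obtain p where p: "p \<in> dihedral n" "\<And>t. p (pt t) = pt (s - t)" using refl_dihedral by metis
  have "p q = pt (s - int q)" if "q \<in> {1..n}" for q using p(2)[of "int q"] that by simp
  hence "(\<lambda>p. if p \<in> A then Some (pt (s - int p)) else None) = (Some \<circ> p) |` A"
    using A by (auto simp: fun_eq_iff restrict_map_def)
  moreover have "cyclic_seq (map p (sorted_list_of_set A))"
    using A sorted_list_of_subset[OF A(1)] by (intro cyclic_seq_short) simp
  ultimately show ?thesis unfolding OPDI_carrier using A p by blast
qed

text \<open>Membership is read off the normal form: rotations preserve orientation on any domain,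
  and a sequence of at most two values is always cyclic.\<close>

lemma wmap_in_OPDI:
  assumes "w \<in> lists D"
  shows "wmap w \<in> carrier (OPDI n)"
  using normal_form[OF assms]
proof
  assume "rot_form w"
  then obtain ts k where "w \<approx> eword ts @ gpow k" by (auto simp: rot_form_def)
  hence "wmap w = wmap (eword ts @ gpow k)" using assms by (rule wmap_weq)
  also have "\<dots> = (\<lambda>p. if p \<in> {1..n} - pt ` set ts then Some (pt (int p + int k)) else None)"
    unfolding wmap_rot_form fun_eq_iff by simp
  finally show ?thesis using restrict_in_OPDI_rot[of "{1..n} - pt ` set ts" k] by simp
next
  assume "refl_form w"
  then obtain a i b where i: "i \<in> {1..m}" and "w \<approx> gpow a @ [Lx i] @ gpow b"
    by (auto simp: refl_form_def)
  hence w: "wmap w = wmap (gpow a @ [Lx i] @ gpow b)" using assms wmap_weq by blast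
  define A where "A = {pt (1 - int a), pt (1 + int i - int a)}"
  have "pt (1 + int i) = i + 1" using x_range[OF i] by (subst pt_eq_nat_iff) auto
  hence dom: "pt (int p + int a) = 1 \<or> pt (int p + int a) = i + 1 \<longleftrightarrow> p \<in> A" if "p \<in> {1..n}" for p
  proof -
    have *: "pt (int p + int a) = pt t \<longleftrightarrow> p = pt (t - int a)" for t
      using pt_eq_nat_iff[OF that, of "t - int a"] pt_eq_iff[of "int p + int a" t]
      by (metis add_diff_eq diff_diff_eq diff_diff_eq2 dvd_diff_commute add.commute)
    show ?thesis using *[of 1] *[of "1 + int i"] \<open>pt (1 + int i) = i + 1\<close> by (simp add: A_def)
  qed
  have A: "A \<subseteq> {1..n}" "card A \<le> 2" unfolding A_def using pt_in by (auto simp: card_insert_if)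
  have "wmap w = (\<lambda>p. if p \<in> A then Some (pt ((2 - int a + int b) - int p)) else None)"
  proof
    fix p
    have "2 - int p - int a + int b = (2 - int a + int b) - int p" by simp
    hence "pt (2 - int p - int a + int b) = pt ((2 - int a + int b) - int p)" by (rule arg_cong)
    thus "wmap w p = (if p \<in> A then Some (pt ((2 - int a + int b) - int p)) else None)"
      unfolding w wmap_refl_form using dom[of p] A(1) by (cases "p \<in> {1..n}") auto
  qed
  thus ?thesis using restrict_in_OPDI_refl[OF A] by simp
qed

section \<open>Realising the elements of the monoid by words\<close>

lemma OPDI_rot_in_image:
  assumes A: "A \<subseteq> {1..n}" and p: "\<And>q. q \<in> A \<Longrightarrow> p q = pt (int q + k)"
  shows "(Some \<circ> p) |` A \<in> wmap ` lists D"
proof -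
  define l where "l = nat (k mod int n)"
  have l: "int l = k mod int n" using n4 by (simp add: l_def)
  have eq: "pt (int q + int l) = pt (int q + k)" for q
    unfolding l using dvd_minus_mod[of "int n" k] by (simp add: pt_eq_iff dvd_diff_commute)
  \<comment> \<open>The idempotents have to kill exactly the points outside
    \<open>A\<close>.\<close>
  define ts where "ts = map int (sorted_list_of_set ({1..n} - A))"
  have "pt ` int ` ({1..n} - A) = {1..n} - A" unfolding image_image by simp
  hence ts: "pt ` set ts = {1..n} - A" by (simp add: ts_def)
  have "(Some \<circ> p) |` A = wmap (eword ts @ gpow l)"
    unfolding fun_eq_iff wmap_rot_form ts eq using A p by (auto simp: restrict_map_def)
  moreover have "eword ts @ gpow l \<in> lists D"
    using pt_in by (auto simp: eword_def in_lists_conv_set)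
  ultimately show ?thesis by blast
qed

text \<open>On at most one point, or on two antipodal points, the reflection agrees with a rotation.
  Otherwise one of the two orders of the points has cyclic distance in \<open>{1..m}\<close>, and a
  conjugate of some \<open>x\<^sub>i\<close> by powers of \<open>g\<close> serves.\<close>

lemma OPDI_refl_in_image:
  assumes A: "A \<subseteq> {1..n}" "card A \<le> 2" and p: "\<And>q. q \<in> A \<Longrightarrow> p q = pt (s - int q)"
  shows "(Some \<circ> p) |` A \<in> wmap ` lists D"
proof -
  have fin: "finite A" using A finite_subset by blast
  consider "A = {}" | u where "A = {u}" | u v where "A = {u, v}" "u \<noteq> v"
  proof -
    have "card A = 0 \<or> card A = Suc 0 \<or> card A = 2" using A by linarith
    thus ?thesis using that(1) that(2) that(3) fin by (auto simp: card_Suc_eq card_2_iff)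
  qed
  thus ?thesis
  proof cases
    case 1
    thus ?thesis using OPDI_rot_in_image[OF A(1), of p 0] by simp
  next
    case 2
    thus ?thesis using OPDI_rot_in_image[OF A(1), of p "s - 2 * int u"] p by simp
  next
    case uv: 3
    have r: "u \<in> {1..n}" "v \<in> {1..n}" using uv A by auto
    have nd: "\<not> int n dvd int v - int u"
      using r uv(2) by (metis pt_eq_iff pt_of_nat)
    show ?thesis
    \<comment> \<open>The rotation by \<open>s - 2 * u\<close> sends \<open>u\<close> to
      \<open>s - u\<close>; it also agrees with the reflection at \<open>v\<close> exactly if
      \<open>n\<close> divides \<open>2 * (u - v)\<close>.\<close>
    proof (cases "int n dvd 2 * (int u - int v)")
      case True
      have "pt (s - int v) = pt (int v + (s - 2 * int u))"
        using True by (simp add: pt_eq_iff algebra_simps)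
      moreover have "pt (s - int u) = pt (int u + (s - 2 * int u))" by simp
      ultimately have "p q = pt (int q + (s - 2 * int u))" if "q \<in> A" for q
        using p[OF that] that uv(1) by auto
      thus ?thesis by (rule OPDI_rot_in_image[OF A(1)])
    next
      case False
      have pick: "(Some \<circ> p) |` A \<in> wmap ` lists D"
        if A_eq: "A = {u, v}" and i: "i \<in> {1..m}" and d: "int n dvd int v - int u - int i" for u v i
      proof -
        have r: "u \<in> {1..n}" "v \<in> {1..n}" using A_eq A by auto
        \<comment> \<open>\<open>a\<close> rotates \<open>u\<close> to \<open>1\<close>, and thus
          \<open>v\<close> to \<open>i + 1\<close>; \<open>b\<close> solves the congruence of
          \<open>2 - a + b\<close> with \<open>s\<close>.\<close>
        define a where "a = nat ((1 - int u) mod int n)"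
        define b where "b = nat ((s - int u - 1) mod int n)"
        have ab: "int a = (1 - int u) mod int n" "int b = (s - int u - 1) mod int n"
          using n4 by (simp_all add: a_def b_def)
        have da: "int n dvd (1 - int u) - int a" and db: "int n dvd (s - int u - 1) - int b"
          unfolding ab by simp_all
        have i1: "i + 1 \<in> {1..n}" using x_range[OF i] by auto
        have "pt (int q + int a) = 1 \<longleftrightarrow> q = u" if q: "q \<in> {1..n}" for q
        proof -
          have "pt (int q + int a) = pt (int q + (1 - int u))"
            using da by (simp add: pt_eq_iff dvd_diff_commute)
          also have "\<dots> = 1 \<longleftrightarrow> int n dvd int q - int u"
            by (subst pt_eq_nat_iff) (use n4 in auto)
          also have "\<dots> \<longleftrightarrow> q = u" using q r by (metis pt_eq_iff pt_of_nat)
          finally show ?thesis .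
        qed
        moreover have "pt (int q + int a) = i + 1 \<longleftrightarrow> q = v" if q: "q \<in> {1..n}" for q
        proof -
          have "pt (int q + int a) = pt (int q + (1 - int u))"
            using da by (simp add: pt_eq_iff dvd_diff_commute)
          also have "\<dots> = pt (int q + (1 + int i - int v))"
            using d by (simp add: pt_eq_iff algebra_simps)
          also have "\<dots> = i + 1 \<longleftrightarrow> int n dvd int q - int v"
            using i1 by (subst pt_eq_nat_iff) auto
          also have "\<dots> \<longleftrightarrow> q = v" using q r by (metis pt_eq_iff pt_of_nat)
          finally show ?thesis .
        qed
        moreover have "pt (2 - int q - int a + int b) = pt (s - int q)" for q
        proof -
          have "int n dvd ((1 - int u) - int a) - ((s - int u - 1) - int b)" using da db by (rule dvd_diff)
          thus ?thesis by (simp add: pt_eq_iff algebra_simps)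
        qed
        ultimately have "(Some \<circ> p) |` A = wmap (gpow a @ [Lx i] @ gpow b)"
          unfolding fun_eq_iff wmap_refl_form using A_eq r p by (auto simp: restrict_map_def)
        moreover have "gpow a @ [Lx i] @ gpow b \<in> lists D" using i by simp
        ultimately show ?thesis by blast
      qed
      define d where "d = (int v - int u) mod int n"
      have d: "0 \<le> d" "d < int n" using n4 by (simp_all add: d_def)
      have dd: "int n dvd int v - int u - d" unfolding d_def by simp
      have d0: "d \<noteq> 0" using nd by (auto simp: d_def dvd_eq_mod_eq_0)
      have d2: "2 * d \<noteq> int n"
      proof
        assume "2 * d = int n"
        moreover have "int n dvd 2 * (int v - int u - d)" using dd by (rule dvd_mult)
        ultimately have "int n dvd 2 * (int v - int u) - int n" by (simp add: algebra_simps)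
        hence "int n dvd (2 * (int v - int u) - int n) + int n" by (rule dvd_add) simp
        hence "int n dvd - (2 * (int u - int v))" by (simp add: algebra_simps)
        thus False using False by (simp only: dvd_minus_iff)
      qed
      \<comment> \<open>If \<open>d\<close> exceeds half of \<open>n\<close>, the points exchange
        roles and the distance becomes \<open>n - d\<close>.\<close>
      show ?thesis
      proof (cases "2 * d < int n")
        case True
        hence "nat d \<in> {1..m}" using d d0 m_eq by auto
        thus ?thesis using pick[OF uv(1)] dd d by simp
      next
        case False
        hence "nat (int n - d) \<in> {1..m}" using d d0 d2 m_eq by auto
        moreover have "int n dvd int u - int v - (int n - d)"
        proof -
          have "int n dvd - (int v - int u - d)" using dd by (simp only: dvd_minus_iff)
          hence "int n dvd - (int v - int u - d) - int n" by (rule dvd_diff) simp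
          thus ?thesis by (simp add: algebra_simps)
        qed
        ultimately show ?thesis using pick[of v u "nat (int n - d)"] uv d by (simp add: insert_commute)
      qed
    qed
  qed
qed

lemma wmap_image: "wmap ` lists D = carrier (OPDI n)"
proof
  show "wmap ` lists D \<subseteq> carrier (OPDI n)" using wmap_in_OPDI by blast
  show "carrier (OPDI n) \<subseteq> wmap ` lists D"
  proof
    fix \<alpha> assume "\<alpha> \<in> carrier (OPDI n)"
    then obtain p A where \<alpha>: "\<alpha> = (Some \<circ> p) |` A" and p: "p \<in> dihedral n" and A: "A \<subseteq> {1..n}"
      and c: "cyclic_seq (map p (sorted_list_of_set A))" unfolding OPDI_carrier by blast
    from dihedral_cases[OF p] show "\<alpha> \<in> wmap ` lists D"
    proof
      assume "is_rot p"
      then obtain k where k: "\<And>t. p (pt t) = pt (t + k)" by (auto simp: is_rot_def)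
      have "p q = pt (int q + k)" if "q \<in> A" for q using k[of "int q"] that A by auto
      thus ?thesis unfolding \<alpha> using A by (intro OPDI_rot_in_image) auto
    next
      assume "is_refl p"
      then obtain s where s: "\<And>t. p (pt t) = pt (s - t)" by (auto simp: is_refl_def)
      have val: "p q = pt (s - int q)" if "q \<in> A" for q using s[of "int q"] that A by auto
      note L = sorted_list_of_subset[OF A]
      have "p q = pt (int (pt s) - int q)" if "q \<in> A" for q
        using val[OF that] pt_pt_add[of s "- int q"] by simp
      hence m: "map p (sorted_list_of_set A) = map (\<lambda>q. pt (int (pt s) - int q)) (sorted_list_of_set A)"
        using finite_subset[OF A] by (intro map_cong refl) simp
      \<comment> \<open>Orientation limits the domain of a reflection to two points, where the
        two-point words suffice.\<close>
      have "\<not> 3 \<le> length (sorted_list_of_set A)"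
        using not_cyclic_seq_refl[OF L(1,2) pt_in, of s] c unfolding m by blast
      hence "card A \<le> 2" using L(3) by simp
      thus ?thesis unfolding \<alpha> using A val by (intro OPDI_refl_in_image) auto
    qed
  qed
qed

lemma OPDI_presentation: "defined_by_presentation (OPDI n) D (relations n m)"
proof (rule defined_by_presentationI[of _ _ wmap])
  show "wmap (u @ v) = wmap u \<otimes>\<^bsub>OPDI n\<^esub> wmap v" for u v
    by (simp add: OPDI_def DI_def sym_inv_monoid_def wmap_append)
  show "(u, v) \<in> R" if "u \<in> lists D" "v \<in> lists D" "wmap u = wmap v" for u v
    using wmap_inject[OF that] weq_iff[OF that(1)] by blast
qed (use relations_lists wmap_relations wmap_image in auto)

section \<open>Counting\<close>

lemma card_alphabet: "card D = n + m + 1"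
proof -
  have "card (Le ` {1..n}) = n" "card (Lx ` {1..m}) = m"
    by (auto simp: card_image inj_on_def)
  moreover have "Le ` {1..n} \<inter> Lx ` {1..m} = {}" by auto
  ultimately have "card (Le ` {1..n} \<union> Lx ` {1..m}) = n + m" by (simp add: card_Un_disjoint)
  moreover have "D = insert Lg (Le ` {1..n} \<union> Lx ` {1..m})" by (simp add: alphabet_def)
  moreover have "Lg \<notin> Le ` {1..n} \<union> Lx ` {1..m}" by auto
  ultimately show ?thesis by simp
qed

lemma eprod_Cons: "a \<le> b \<Longrightarrow> eprod a b = Le a # eprod (a + 1) b"
  by (simp add: eprod_def upt_conv_Cons del: upt_Suc)


text \<open>The left-hand sides determine the relations, and they are easier to count: those of
  \<open>Q\<^sub>6\<close> to \<open>Q\<^sub>9\<close> are all the words \<open>e\<^sub>j x\<^sub>i\<close> and \<open>x\<^sub>i e\<^sub>j\<close>.\<close>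

definition rhs :: "letter list \<Rightarrow> letter list" where
  "rhs u = (case (u ! 0, u ! 1) of
      (Lg, Le j) \<Rightarrow> if length u = 2 then [Le (if j = 1 then n else j - 1), Lg] else eprod 1 n
    | (Le i, Le j) \<Rightarrow> if i = j then [Le i] else [Le j, Le i]
    | (Le j, Lx i) \<Rightarrow> if j = 1 then [Lx i, Le 1] else if j = i + 1 then eprod 2 n else [Lx i]
    | (Lx i, Le j) \<Rightarrow>
        if j = 1 then gpow (n - 2 * i) @ eprod 1 (n - i) @ eprod (n - i + 2) n
        else if j = n - i + 1 then [Le (i + 1), Lx i] else [Lx i]
    | (Lx i, Lg) \<Rightarrow> eprod 2 i @ eprod (i + 2) n
    | _ \<Rightarrow> [])"

lemma relations_rhs:
  assumes "(u, v) \<in> relations n m"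
  shows "v = rhs u"
proof -
  have "m < n" using m_eq n4 by auto
  \<comment> \<open>The left-hand sides of Q5 and of the first relation in Q4 both begin with
    \<open>Lg\<close>, \<open>Le 1\<close>; the length tells them apart.\<close>
  have "length (eprod (Suc 0) n) = n" by (simp add: eprod_def)
  moreover have "eprod (Suc 0) n ! 0 = Le (Suc 0)" using eprod_Cons[of 1 n] n4 by simp
  moreover have "(gpow i @ w) ! 0 = Lg" if "Suc 0 \<le> i" for i w using that by (simp add: nth_append)
  ultimately show ?thesis
    using assms n4 \<open>m < n\<close> unfolding relations_def
    by (elim UnE) (auto simp: rhs_def)
qed

lemma fst_relations:
  "fst ` relations n m =
     {gpow n, Lg # eprod 1 n} \<union> (\<lambda>i. [Lg, Le i]) ` {1..n}
     \<union> (\<lambda>(i, j). [Le i, Le j]) ` (SIGMA i:{1..n}. {i..n})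
     \<union> (\<lambda>(i, j). [Le j, Lx i]) ` ({1..m} \<times> {1..n})
     \<union> (\<lambda>(i, j). [Lx i, Le j]) ` ({1..m} \<times> {1..n})
     \<union> (\<lambda>i. Lx i # gpow i @ Lx i # gpow i) ` {1..m}" (is "?L = ?R")
proof
  have "m < n" using m_eq n4 by auto
  show "?L \<subseteq> ?R"
  proof
    fix w assume "w \<in> ?L"
    then obtain v where "(w, v) \<in> relations n m" by auto
    thus "w \<in> ?R"
      unfolding relations_def using n4 \<open>m < n\<close> by (elim UnE) (auto simp: image_iff)
  qed
  have mem: "u \<in> ?L" if "(u, v) \<in> relations n m" for u v
    using that by (rule image_eqI[rotated]) simp
  have B: "[Lg, Le i] \<in> ?L" if "i \<in> {1..n}" for i
  proof (cases "i = 1")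
    case True
    show ?thesis by (rule mem[of _ "[Le n, Lg]"]) (use True in \<open>auto simp: relations_def\<close>)
  next
    case False
    have "([Lg, Le ((i - 1) + 1)], [Le (i - 1), Lg]) \<in> relations n m"
      using that False unfolding relations_def by (intro UnI1 UnI2) auto
    thus ?thesis using that mem by simp
  qed
  have C: "[Le i, Le j] \<in> ?L" if "i \<in> {1..n}" "j \<in> {i..n}" for i j
  proof (cases "i = j")
    case True
    show ?thesis by (rule mem[of _ "[Le i]"]) (use that True in \<open>auto simp: relations_def\<close>)
  next
    case False
    show ?thesis by (rule mem[of _ "[Le j, Le i]"]) (use that False in \<open>auto simp: relations_def\<close>)
  qed
  have E: "[Le j, Lx i] \<in> ?L" if "i \<in> {1..m}" "j \<in> {1..n}" for i j
  proof -
    consider "j = 1" | "j = i + 1" | "j \<noteq> 1" "j \<noteq> i + 1" by blast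
    thus ?thesis
    proof cases
      case 1
      show ?thesis by (rule mem[of _ "[Lx i, Le 1]"]) (use that 1 in \<open>auto simp: relations_def\<close>)
    next
      case 2
      show ?thesis by (rule mem[of _ "eprod 2 n"]) (use that 2 in \<open>auto simp: relations_def\<close>)
    next
      case 3
      show ?thesis by (rule mem[of _ "[Lx i]"]) (use that 3 in \<open>auto simp: relations_def\<close>)
    qed
  qed
  have F: "[Lx i, Le j] \<in> ?L" if "i \<in> {1..m}" "j \<in> {1..n}" for i j
  proof -
    consider "j = 1" | "j = n - i + 1" | "j \<noteq> 1" "j \<noteq> n - i + 1" by blast
    thus ?thesis
    proof cases
      case 1
      show ?thesis by (rule mem[of _ "gpow (n - 2 * i) @ eprod 1 (n - i) @ eprod (n - i + 2) n"])
          (use that 1 in \<open>auto simp: relations_def\<close>)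
    next
      case 2
      show ?thesis by (rule mem[of _ "[Le (i + 1), Lx i]"]) (use that 2 in \<open>auto simp: relations_def\<close>)
    next
      case 3
      show ?thesis by (rule mem[of _ "[Lx i]"]) (use that 3 in \<open>auto simp: relations_def\<close>)
    qed
  qed
  have G: "Lx i # gpow i @ Lx i # gpow i \<in> ?L" if "i \<in> {1..m}" for i
    by (rule mem[of _ "eprod 2 i @ eprod (i + 2) n"]) (use that in \<open>auto simp: relations_def\<close>)
  have A1: "gpow n \<in> ?L" by (rule mem[of _ "[]"]) (auto simp: relations_def)
  have A2: "Lg # eprod 1 n \<in> ?L" by (rule mem[of _ "eprod 1 n"]) (auto simp: relations_def)
  have A: "{gpow n, Lg # eprod 1 n} \<subseteq> ?L" using A1 A2 by blast
  show "?R \<subseteq> ?L"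
    by (intro Un_least image_subsetI A;
        (elim SigmaE, simp only: prod.case)?; intro B C E F G)
qed

text \<open>Exposes the first two letters, by which the left-hand side of Q1 is told apart from the
  others.\<close>

lemma gpow_Suc_Suc: "gpow n = Lg # Lg # gpow (n - 2)"
proof -
  have "n = Suc (Suc (n - 2))" using n4 by simp
  thus ?thesis by (metis replicate_Suc)
qed

text \<open>The doubled count avoids dividing \<open>n * (n + 1)\<close>. Q1 and Q5 contribute 2, Q2
  and Q3 together the pairs \<open>i \<le> j\<close>, Q4 gives \<open>n\<close>, Q6 to Q9 give
  \<open>2 * m * n\<close>, and Q10 gives \<open>m\<close>.\<close>

lemma card_relations: "2 * card (relations n m) = n * (n + 1) + 2 * n + 4 + 2 * m * (2 * n + 1)"
proof -
  let ?A = "{gpow n, Lg # eprod 1 n}"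
  let ?B = "(\<lambda>i. [Lg, Le i]) ` {1..n}"
  let ?C = "(\<lambda>(i, j). [Le i, Le j]) ` (SIGMA i:{1..n}. {i..n})"
  let ?E = "(\<lambda>(i, j). [Le j, Lx i]) ` ({1..m} \<times> {1..n})"
  let ?F = "(\<lambda>(i, j). [Lx i, Le j]) ` ({1..m} \<times> {1..n})"
  let ?G = "(\<lambda>i. Lx i # gpow i @ Lx i # gpow i) ` {1..m}"
  have eprod_1: "eprod 1 n = Le 1 # Le 2 # eprod 3 n"
    using eprod_Cons[of 1 n, unfolded one_add_one] eprod_Cons[of 2 n] n4 by simp
  have A: "card ?A = 2" unfolding gpow_Suc_Suc eprod_1 by simp
  have B: "card ?B = n" by (simp add: card_image inj_on_def)
  have "card ?C = card (SIGMA i:{1..n}. {i..n})" by (intro card_image) (auto simp: inj_on_def)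
  also have "\<dots> = (\<Sum>i=1..n. n + 1 - i)" by (simp add: card_SigmaI)
  also have "\<dots> = (\<Sum>i=1..n. i)"
    by (rule sum.reindex_bij_witness[of _ "\<lambda>i. n + 1 - i" "\<lambda>i. n + 1 - i"]) auto
  finally have "card ?C = (\<Sum>i=1..n. i)" .
  hence C: "2 * card ?C = n * (n + 1)" using double_gauss_sum_from_Suc_0[of n, where ?'a = nat] by simp
  have E: "card ?E = m * n" by (subst card_image) (auto simp: inj_on_def)
  have F: "card ?F = m * n" by (subst card_image) (auto simp: inj_on_def)
  have G: "card ?G = m" by (subst card_image) (auto simp: inj_on_def)
  have second: "gpow i @ w = Lg # (gpow (i - 1) @ w)" if "1 \<le> i" for i w
    using that by (cases i) auto
  have disj: "?A \<inter> ?B = {}" "(?A \<union> ?B) \<inter> ?C = {}" "(?A \<union> ?B \<union> ?C) \<inter> ?E = {}"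
    "(?A \<union> ?B \<union> ?C \<union> ?E) \<inter> ?F = {}" "(?A \<union> ?B \<union> ?C \<union> ?E \<union> ?F) \<inter> ?G = {}"
    unfolding gpow_Suc_Suc eprod_1 by (auto simp: second)
  have "inj_on fst (relations n m)" by (rule inj_onI) (metis relations_rhs prod.collapse)
  hence "card (relations n m) = card (?A \<union> ?B \<union> ?C \<union> ?E \<union> ?F \<union> ?G)"
    using card_image fst_relations by metis
  also have "\<dots> = card ?A + card ?B + card ?C + card ?E + card ?F + card ?G"
    by (subst card_Un_disjoint, simp, simp, rule disj)+ simp
  finally show ?thesis using A B C E F G by (simp add: algebra_simps)
qed

end

theorem theorem5p9:
  fixes n m :: nat
  assumes "n \<ge> 4" and "m = (n - 1) div 2"
  shows "card (alphabet n m) = n + m + 1 \<and>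
         real (card (relations n m)) =
           1 / 2 * (3 * real n ^ 2 + (1 - (- 1) ^ n) * real n + 3 - (1 + (- 1) ^ n) / 2) \<and>
         defined_by_presentation (OPDI n) (alphabet n m) (relations n m)"
proof -
  interpret opdi n m using assms by unfold_locales
  have c: "2 * real (card (relations n m)) =
      real n * (real n + 1) + 2 * real n + 4 + 2 * real m * (2 * real n + 1)"
    using arg_cong[OF card_relations, of real] by (simp add: algebra_simps)
  have "real (card (relations n m)) =
      1 / 2 * (3 * real n ^ 2 + (1 - (- 1) ^ n) * real n + 3 - (1 + (- 1) ^ n) / 2)"
  \<comment> \<open>Parity fixes both the sign \<open>(- 1) ^ n\<close> and the value of
    \<open>2 * m\<close>, which is \<open>n - 2\<close> or \<open>n - 1\<close>.\<close>
  proof (cases "even n")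
    case True
    hence "n = 2 * m + 2" using assms by (elim evenE) auto
    hence "2 * real m = real n - 2" by simp
    with c have "2 * real (card (relations n m)) =
      real n * (real n + 1) + 2 * real n + 4 + (real n - 2) * (2 * real n + 1)" by metis
    thus ?thesis using True by (simp add: power2_eq_square algebra_simps)
  next
    case False
    hence "n = 2 * m + 1" using assms by (elim oddE) auto
    hence "2 * real m = real n - 1" by simp
    with c have "2 * real (card (relations n m)) =
      real n * (real n + 1) + 2 * real n + 4 + (real n - 1) * (2 * real n + 1)" by metis
    thus ?thesis using False by (simp add: power2_eq_square algebra_simps)
  qed
  thus ?thesis using card_alphabet OPDI_presentation by blast
qed

end
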